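(* Let $\mathcal A$ be a unital prime algebra over a field $\mathbb F$ and let $\xi\in\mathbb F$ with $\xi\ne0$. Let $\delta:\mathcal A\to\mathcal A$ be an additive generalized $\xi$-Lie derivation with relating $\xi$-Lie derivation $L:\mathcal A\to\mathcal A$. (1) If $\xi=1$ (that is, $\delta$ is an additive generalized Lie derivation) and $\deg(\mathcal A)\ge3$, then there exist an additive generalized derivation $\delta':\mathcal A\to\mathcal{AC}$ and an additive map $h:\mathcal A\to\mathcal C$ with $h([A,B])=0$ for all $A,B\in\mathcal A$, such that $\delta(A)=\delta'(A)+h(A)$ for all $A\in\mathcal A$. (2) If $\xi=-1$ (that is, $\delta$ is an additive generalized Jordan derivation) and $\mathbb F$ is of characteristic not $2$, then $\delta$ is an additive generalized derivation. (3) If $\xi\ne\pm1$, $\mathbb F$ is of characteristic not $2$, and $\mathcal A$ contains a nontrivial idempotent, then $\delta$ is an additive generalized derivation and $\delta(\xi A)=\xi\delta(A)$ for all $A\in\mathcal A$.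
   Context: Algebras are associative. An algebra $\mathcal A$ over a field $\mathbb F$ is prime if, for $A,B\in\mathcal A$, $A\mathcal A B=0$ implies $A=0$ or $B=0$. A nontrivial idempotent of a unital algebra with unit $I$ is an element $P=P^2$ with $P\ne0,I$. For $\xi\in\mathbb F$, $[A,B]_\xi=AB-\xi BA$ and $[A,B]=AB-BA$. An additive map $L:\mathcal A\to\mathcal A$ is an additive $\xi$-Lie derivation if $L([A,B]_\xi)=[L(A),B]_\xi+[A,L(B)]_\xi$ for all $A,B\in\mathcal A$. An additive map $\delta:\mathcal A\to\mathcal A$ is an additive generalized $\xi$-Lie derivation if there exists an additive $\xi$-Lie derivation $L:\mathcal A\to\mathcal A$ such that $$\delta([A,B]_\xi)=\delta(A)B-\xi\delta(B)A+AL(B)-\xi BL(A)\quad\text{for all }A,B\in\mathcal A;$$ such an $L$ is called the relating $\xi$-Lie derivation of $\delta$. For $\xi=1$, $\delta$ is called an additive generalized Lie derivation, and for $\xi=-1$ an additive generalized Jordan derivation. If $\mathcal R$ is an algebra containing $\mathcal A$ as a subalgebra, an additive map $\tau:\mathcal A\to\mathcal R$ is an additive derivation if $\tau(AB)=\tau(A)B+A\tau(B)$ for all $A,B\in\mathcal A$, and an additive map $\delta':\mathcal A\to\mathcal R$ is an additive generalized derivation if there is an additive derivation $\tau:\mathcal A\to\mathcal R$ such that $\delta'(AB)=\delta'(A)B+A\tau(B)$ for all $A,B\in\mathcal A$. $\mathcal Z(\mathcal A)$ is the center of $\mathcal A$. $\mathcal Q=\mathcal Q_{mr}(\mathcal A)$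 is the maximal right ring of quotients of $\mathcal A$; its center $\mathcal C$ is a field, called the extended centroid of $\mathcal A$. The central closure $\mathcal{AC}$ of $\mathcal A$ is the $\mathcal C$-subalgebra of $\mathcal Q$ generated by $\mathcal A$. Degree of algebraicity: $A\in\mathcal A$ is algebraic over $\mathcal Z(\mathcal A)$ if there exist $Z_0,\dots,Z_n\in\mathcal Z(\mathcal A)$ with $Z_n\ne0$ and $Z_0+Z_1A+\cdots+Z_nA^n=0$; the least such $n$ is $\deg(A)$, and $\deg(A)=\infty$ if $A$ is not algebraic. $\deg(\mathcal A)=\sup\{\deg(A):A\in\mathcal A\}$. *)

theory Defs
  imports Complex_Main "HOL-Library.Extended_Nat"
begin

section \<open>Prime algebras over a field and degree of algebraicity\<close>

locale unital_algebra = vector_space scale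
  for scale :: "'f::field \<Rightarrow> 'a::ring_1 \<Rightarrow> 'a" +
  assumes scale_mult_left: "scale c x * y = scale c (x * y)"
    and scale_mult_right: "x * scale c y = scale c (x * y)"

text \<open>The class \<open>ring_1\<close> includes \<open>0 \<noteq> 1\<close>, so a prime algebra is nonzero.\<close>

locale unital_prime_algebra = unital_algebra scale
  for scale :: "'f::field \<Rightarrow> 'a::ring_1 \<Rightarrow> 'a" +
  assumes prime: "(\<forall>x::'a. a * x * b = 0) \<Longrightarrow> a = 0 \<or> b = 0"

definition nontrivial_idempotent :: "'a::ring_1 \<Rightarrow> bool" where
  "nontrivial_idempotent p \<longleftrightarrow> p * p = p \<and> p \<noteq> 0 \<and> p \<noteq> 1"

definition center :: "'a::ring set" where
  "center = {z. \<forall>x. z * x = x * z}"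

text \<open>The infimum of the empty set is \<open>\<infinity>\<close>, the degree of an element that is
  not algebraic over the center.\<close>

definition deg_elt :: "'a::ring_1 \<Rightarrow> enat" where
  "deg_elt a = (INF n \<in> {n. \<exists>z :: nat \<Rightarrow> 'a. (\<forall>i\<le>n. z i \<in> center) \<and> z n \<noteq> 0 \<and>
      (\<Sum>i\<le>n. z i * a ^ i) = 0}. enat n)"

definition deg_alg :: "'a::ring_1 itself \<Rightarrow> enat" where
  "deg_alg _ = (SUP a :: 'a. deg_elt a)"


section \<open>The maximal right ring of quotients\<close>

text \<open>Elements are classes of pairs \<open>(D, f)\<close> with \<open>D\<close> a dense right ideal and \<open>f : D \<rightarrow> A\<close> a
  homomorphism of right modules. Two pairs are identified if the maps agree on some dense right
  ideal contained in both domains. The value of \<open>f\<close> outside \<open>D\<close> is irrelevant.\<close>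

definition right_ideal :: "'a::ring_1 set \<Rightarrow> bool" where
  "right_ideal D \<longleftrightarrow> 0 \<in> D \<and> (\<forall>x\<in>D. \<forall>y\<in>D. x + y \<in> D) \<and> (\<forall>x\<in>D. \<forall>r. x * r \<in> D)"

definition dense_right_ideal :: "'a::ring_1 set \<Rightarrow> bool" where
  "dense_right_ideal D \<longleftrightarrow> right_ideal D \<and>
    (\<forall>a b. a \<noteq> 0 \<longrightarrow> (\<exists>r. a * r \<noteq> 0 \<and> b * r \<in> D))"

definition right_module_hom_on :: "'a::ring_1 set \<Rightarrow> ('a \<Rightarrow> 'a) \<Rightarrow> bool" where
  "right_module_hom_on D f \<longleftrightarrow>
    (\<forall>x\<in>D. \<forall>y\<in>D. f (x + y) = f x + f y) \<and> (\<forall>x\<in>D. \<forall>r. f (x * r) = f x * r)"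

definition qmr_repr :: "'a::ring_1 set \<times> ('a \<Rightarrow> 'a) \<Rightarrow> bool" where
  "qmr_repr p \<longleftrightarrow> dense_right_ideal (fst p) \<and> right_module_hom_on (fst p) (snd p)"

definition qmr_rel :: "'a::ring_1 set \<times> ('a \<Rightarrow> 'a) \<Rightarrow> 'a set \<times> ('a \<Rightarrow> 'a) \<Rightarrow> bool" where
  "qmr_rel p q \<longleftrightarrow> qmr_repr p \<and> qmr_repr q \<and>
    (\<exists>K. dense_right_ideal K \<and> K \<subseteq> fst p \<inter> fst q \<and> (\<forall>x\<in>K. snd p x = snd q x))"

lemma dense_UNIV: "dense_right_ideal UNIV"
  by (auto simp: dense_right_ideal_def right_ideal_def intro: exI[of _ 1])

lemma dense_vimage:
  assumes "dense_right_ideal D" "dense_right_ideal E" "right_module_hom_on E g"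
  shows "dense_right_ideal {x \<in> E. g x \<in> D}"
proof -
  have "g (0 * 0) = g 0 * 0"
    using assms(2,3) unfolding dense_right_ideal_def right_ideal_def right_module_hom_on_def
    by blast
  hence g0: "g 0 = 0" by simp
  have "\<exists>r. a * r \<noteq> 0 \<and> b * r \<in> E \<and> g (b * r) \<in> D" if a: "a \<noteq> 0" for a b
  proof -
    obtain r where r: "a * r \<noteq> 0" "b * r \<in> E"
      using a assms(2) unfolding dense_right_ideal_def by blast
    obtain s where s: "(a * r) * s \<noteq> 0" "g (b * r) * s \<in> D"
      using r assms(1) unfolding dense_right_ideal_def by blast
    have "b * r * s \<in> E" "g (b * r * s) = g (b * r) * s"
      using r assms(2,3)
      by (auto simp: dense_right_ideal_def right_ideal_def right_module_hom_on_def)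
    with s show ?thesis by (intro exI[of _ "r * s"]) (simp add: mult.assoc)
  qed
  thus ?thesis
    using assms g0
    by (simp add: dense_right_ideal_def right_ideal_def right_module_hom_on_def)
qed

lemma dense_Int:
  assumes "dense_right_ideal D" "dense_right_ideal E"
  shows "dense_right_ideal (D \<inter> E)"
proof -
  have "right_module_hom_on E (\<lambda>x. x)" by (simp add: right_module_hom_on_def)
  from dense_vimage[OF assms this] have "dense_right_ideal {x \<in> E. x \<in> D}" .
  moreover have "{x \<in> E. x \<in> D} = D \<inter> E" by blast
  ultimately show ?thesis by simp
qed

lemma qmr_relI:
  assumes "qmr_repr p" "qmr_repr q" "\<And>x. x \<in> fst p \<Longrightarrow> x \<in> fst q \<Longrightarrow> snd p x = snd q x"
  shows "qmr_rel p q"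
  using assms dense_Int unfolding qmr_rel_def qmr_repr_def
  by (intro conjI exI[of _ "fst p \<inter> fst q"]) auto

lemma qmr_rel_reprD: "qmr_rel p q \<Longrightarrow> qmr_repr p" "qmr_rel p q \<Longrightarrow> qmr_repr q"
  by (auto simp: qmr_rel_def)

lemma qmr_rel_refl: "qmr_repr p \<Longrightarrow> qmr_rel p p"
  by (rule qmr_relI) auto

lemma part_equivp_qmr_rel: "part_equivp qmr_rel"
proof (rule part_equivpI)
  have "qmr_repr (UNIV, \<lambda>x::'a. x)"
    by (simp add: qmr_repr_def dense_UNIV right_module_hom_on_def)
  thus "\<exists>x::'a set \<times> ('a \<Rightarrow> 'a). qmr_rel x x" using qmr_rel_refl by blast
  show "symp (qmr_rel :: 'a set \<times> ('a \<Rightarrow> 'a) \<Rightarrow> _)"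
    unfolding qmr_rel_def by (rule sympI) (metis inf_commute)
  show "transp (qmr_rel :: 'a set \<times> ('a \<Rightarrow> 'a) \<Rightarrow> _)"
  proof (rule transpI)
    fix p q r :: "'a set \<times> ('a \<Rightarrow> 'a)"
    assume pq: "qmr_rel p q" and qr: "qmr_rel q r"
    obtain K where K: "dense_right_ideal K" "K \<subseteq> fst p \<inter> fst q" "\<forall>x\<in>K. snd p x = snd q x"
      using pq by (auto simp: qmr_rel_def)
    obtain M where M: "dense_right_ideal M" "M \<subseteq> fst q \<inter> fst r" "\<forall>x\<in>M. snd q x = snd r x"
      using qr by (auto simp: qmr_rel_def)
    show "qmr_rel p r"
      unfolding qmr_rel_def
      using pq qr dense_Int[OF K(1) M(1)] K M
      by (intro conjI exI[of _ "K \<inter> M"]) (auto simp: qmr_rel_def)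
  qed
qed

quotient_type (overloaded) 'a qmr = "'a::ring_1 set \<times> ('a \<Rightarrow> 'a)" / partial: qmr_rel
  by (rule part_equivp_qmr_rel)

definition qmr_plus where
  "qmr_plus p q = (fst p \<inter> fst q, \<lambda>x. snd p x + snd q x)"

definition qmr_uminus where
  "qmr_uminus p = (fst p, \<lambda>x. - snd p x)"

definition qmr_times where
  "qmr_times p q = ({x \<in> fst q. snd q x \<in> fst p}, \<lambda>x. snd p (snd q x))"

definition left_mult :: "'a::ring_1 \<Rightarrow> 'a set \<times> ('a \<Rightarrow> 'a)" where
  "left_mult a = (UNIV, \<lambda>x. a * x)"

lemma repr_left_mult: "qmr_repr (left_mult a)"
  by (simp add: qmr_repr_def left_mult_def dense_UNIV right_module_hom_on_def
      distrib_left mult.assoc)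

lemma repr_plus: "qmr_repr p \<Longrightarrow> qmr_repr q \<Longrightarrow> qmr_repr (qmr_plus p q)"
  by (simp add: qmr_repr_def qmr_plus_def dense_Int right_module_hom_on_def algebra_simps)

lemma repr_uminus: "qmr_repr p \<Longrightarrow> qmr_repr (qmr_uminus p)"
  by (simp add: qmr_repr_def qmr_uminus_def right_module_hom_on_def)

lemma repr_times: "qmr_repr p \<Longrightarrow> qmr_repr q \<Longrightarrow> qmr_repr (qmr_times p q)"
  by (simp add: qmr_repr_def qmr_times_def dense_vimage) (simp add: right_module_hom_on_def)

lemmas repr_intros = repr_left_mult repr_plus repr_uminus repr_times

lemma plus_rsp:
  assumes "qmr_rel p p'" "qmr_rel q q'"
  shows "qmr_rel (qmr_plus p q) (qmr_plus p' q')"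
proof -
  obtain K where K: "dense_right_ideal K" "K \<subseteq> fst p \<inter> fst p'" "\<forall>x\<in>K. snd p x = snd p' x"
    using assms(1) by (auto simp: qmr_rel_def)
  obtain M where M: "dense_right_ideal M" "M \<subseteq> fst q \<inter> fst q'" "\<forall>x\<in>M. snd q x = snd q' x"
    using assms(2) by (auto simp: qmr_rel_def)
  show ?thesis
    unfolding qmr_rel_def
    using assms[THEN qmr_rel_reprD(1)] assms[THEN qmr_rel_reprD(2)] dense_Int[OF K(1) M(1)] K M
    by (intro conjI exI[of _ "K \<inter> M"] repr_plus) (auto simp: qmr_plus_def)
qed

lemma uminus_rsp:
  assumes "qmr_rel p p'"
  shows "qmr_rel (qmr_uminus p) (qmr_uminus p')"
proof -
  obtain K where K: "dense_right_ideal K" "K \<subseteq> fst p \<inter> fst p'" "\<forall>x\<in>K. snd p x = snd p' x"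
    using assms by (auto simp: qmr_rel_def)
  show ?thesis
    unfolding qmr_rel_def
    using assms[THEN qmr_rel_reprD(1)] assms[THEN qmr_rel_reprD(2)] K
    by (intro conjI exI[of _ K] repr_uminus) (auto simp: qmr_uminus_def)
qed

lemma times_rsp:
  assumes "qmr_rel p p'" "qmr_rel q q'"
  shows "qmr_rel (qmr_times p q) (qmr_times p' q')"
proof -
  obtain K where K: "dense_right_ideal K" "K \<subseteq> fst p \<inter> fst p'" "\<forall>x\<in>K. snd p x = snd p' x"
    using assms(1) by (auto simp: qmr_rel_def)
  obtain M where M: "dense_right_ideal M" "M \<subseteq> fst q \<inter> fst q'" "\<forall>x\<in>M. snd q x = snd q' x"
    using assms(2) by (auto simp: qmr_rel_def)
  have "dense_right_ideal (M \<inter> {x \<in> fst q. snd q x \<in> K})"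
    using assms(2) K(1) M(1) by (intro dense_Int dense_vimage) (auto simp: qmr_rel_def qmr_repr_def)
  thus ?thesis
    unfolding qmr_rel_def
    using assms[THEN qmr_rel_reprD(1)] assms[THEN qmr_rel_reprD(2)] K M
    by (intro conjI exI[of _ "M \<inter> {x \<in> fst q. snd q x \<in> K}"] repr_times)
      (auto simp: qmr_times_def)
qed

text \<open>The canonical embedding of the ring into its ring of quotients.\<close>

lift_definition to_qmr :: "'a::ring_1 \<Rightarrow> 'a qmr" is left_mult
  by (rule qmr_rel_refl[OF repr_left_mult])

instantiation qmr :: (ring_1) ring_1
begin

lift_definition zero_qmr :: "'a qmr" is "left_mult 0"
  by (rule qmr_rel_refl[OF repr_left_mult])
lift_definition one_qmr :: "'a qmr" is "left_mult 1"
  by (rule qmr_rel_refl[OF repr_left_mult])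
lift_definition plus_qmr :: "'a qmr \<Rightarrow> 'a qmr \<Rightarrow> 'a qmr" is qmr_plus
  by (rule plus_rsp)
lift_definition uminus_qmr :: "'a qmr \<Rightarrow> 'a qmr" is qmr_uminus
  by (rule uminus_rsp)
lift_definition minus_qmr :: "'a qmr \<Rightarrow> 'a qmr \<Rightarrow> 'a qmr" is "\<lambda>p q. qmr_plus p (qmr_uminus q)"
  by (intro plus_rsp uminus_rsp)
lift_definition times_qmr :: "'a qmr \<Rightarrow> 'a qmr \<Rightarrow> 'a qmr" is qmr_times
  by (rule times_rsp)

instance
proof
  fix a b c :: "'a qmr"
  show "a + b + c = a + (b + c)"
    by (transfer, (drule qmr_rel_reprD(1))+, intro qmr_relI repr_intros)
      (auto simp: qmr_plus_def add.assoc)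
  show "a + b = b + a"
    by (transfer, (drule qmr_rel_reprD(1))+, intro qmr_relI repr_intros)
      (auto simp: qmr_plus_def add.commute)
  show "0 + a = a"
    by (transfer, (drule qmr_rel_reprD(1))+, intro qmr_relI repr_intros)
      (auto simp: qmr_plus_def left_mult_def)
  show "- a + a = 0"
    by (transfer, (drule qmr_rel_reprD(1))+, intro qmr_relI repr_intros)
      (auto simp: qmr_plus_def qmr_uminus_def left_mult_def)
  show "a - b = a + - b"
    by (transfer, (drule qmr_rel_reprD(1))+, intro qmr_relI repr_intros)
      auto
  show "a * b * c = a * (b * c)"
    by (transfer, (drule qmr_rel_reprD(1))+, intro qmr_relI repr_intros)
      (auto simp: qmr_times_def)
  show "1 * a = a"
    by (transfer, (drule qmr_rel_reprD(1))+, intro qmr_relI repr_intros)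
      (auto simp: qmr_times_def left_mult_def)
  show "a * 1 = a"
    by (transfer, (drule qmr_rel_reprD(1))+, intro qmr_relI repr_intros)
      (auto simp: qmr_times_def left_mult_def)
  show "(a + b) * c = a * c + b * c"
    by (transfer, (drule qmr_rel_reprD(1))+, intro qmr_relI repr_intros)
      (auto simp: qmr_times_def qmr_plus_def)
  show "a * (b + c) = a * b + a * c"
  proof transfer
    fix p q r :: "'a set \<times> ('a \<Rightarrow> 'a)"
    assume "qmr_rel p p" "qmr_rel q q" "qmr_rel r r"
    hence rep: "qmr_repr p" "qmr_repr q" "qmr_repr r" by (auto dest: qmr_rel_reprD)
    show "qmr_rel (qmr_times p (qmr_plus q r)) (qmr_plus (qmr_times p q) (qmr_times p r))"
      using rep by (intro qmr_relI repr_intros)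
        (auto simp: qmr_times_def qmr_plus_def qmr_repr_def right_module_hom_on_def)
  qed
  show "(0 :: 'a qmr) \<noteq> 1"
  proof (transfer, rule notI)
    assume "qmr_rel (left_mult (0::'a)) (left_mult 1)"
    then obtain K where K: "dense_right_ideal K" "\<forall>x\<in>K. x = (0::'a)"
      by (auto simp: qmr_rel_def left_mult_def)
    obtain r :: 'a where "1 * r \<noteq> 0" "1 * r \<in> K"
      using K(1) unfolding dense_right_ideal_def by (metis one_neq_zero)
    with K(2) show False by simp
  qed
qed

end

lemma to_qmr_add: "to_qmr (a + b) = to_qmr a + to_qmr b"
  by (transfer, intro qmr_relI repr_intros)
    (simp_all add: qmr_plus_def left_mult_def distrib_right)

lemma to_qmr_mult: "to_qmr (a * b) = to_qmr a * to_qmr b"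
  by (transfer, intro qmr_relI repr_intros)
    (simp_all add: qmr_times_def left_mult_def mult.assoc)

lemma to_qmr_one: "to_qmr 1 = 1"
  by transfer (rule qmr_rel_refl[OF repr_left_mult])

lemma inj_to_qmr: "inj (to_qmr :: 'a::ring_1 \<Rightarrow> 'a qmr)"
proof (rule injI, transfer, rule ccontr)
  fix a b :: 'a
  assume rel: "qmr_rel (left_mult a) (left_mult b)" and "a \<noteq> b"
  obtain K where K: "dense_right_ideal K" "\<forall>x\<in>K. a * x = b * x"
    using rel by (auto simp: qmr_rel_def left_mult_def)
  obtain r where r: "(a - b) * r \<noteq> 0" "1 * r \<in> K"
    using K(1) \<open>a \<noteq> b\<close> unfolding dense_right_ideal_def by (metis right_minus_eq)
  with K(2) show False by (simp add: left_diff_distrib)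
qed

abbreviation extended_centroid :: "'a::ring_1 qmr set" where
  "extended_centroid \<equiv> center"

definition centroid_subalgebra :: "'a::ring_1 qmr set \<Rightarrow> bool" where
  "centroid_subalgebra S \<longleftrightarrow> 0 \<in> S \<and> (\<forall>x\<in>S. \<forall>y\<in>S. x + y \<in> S \<and> x * y \<in> S) \<and>
    (\<forall>c\<in>extended_centroid. \<forall>x\<in>S. c * x \<in> S)"

definition central_closure :: "'a::ring_1 qmr set" where
  "central_closure = centroid_subalgebra hull range to_qmr"


section \<open>Derivations\<close>

definition commutator :: "'a::ring \<Rightarrow> 'a \<Rightarrow> 'a" where
  "commutator a b = a * b - b * a"

definition xi_bracket :: "('f \<Rightarrow> 'a \<Rightarrow> 'a) \<Rightarrow> 'f \<Rightarrow> 'a::ring \<Rightarrow> 'a \<Rightarrow> 'a" where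
  "xi_bracket scale \<xi> a b = a * b - scale \<xi> (b * a)"

definition xi_Lie_derivation ::
    "('f \<Rightarrow> 'a \<Rightarrow> 'a) \<Rightarrow> 'f \<Rightarrow> ('a::ring \<Rightarrow> 'a) \<Rightarrow> bool" where
  "xi_Lie_derivation scale \<xi> L \<longleftrightarrow> additive L \<and>
    (\<forall>a b. L (xi_bracket scale \<xi> a b) = xi_bracket scale \<xi> (L a) b + xi_bracket scale \<xi> a (L b))"

definition relating_xi_Lie_derivation ::
    "('f \<Rightarrow> 'a \<Rightarrow> 'a) \<Rightarrow> 'f \<Rightarrow> ('a::ring \<Rightarrow> 'a) \<Rightarrow> ('a \<Rightarrow> 'a) \<Rightarrow> bool" where
  "relating_xi_Lie_derivation scale \<xi> \<delta> L \<longleftrightarrow> xi_Lie_derivation scale \<xi> L \<and>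
    (\<forall>a b. \<delta> (xi_bracket scale \<xi> a b) =
      \<delta> a * b - scale \<xi> (\<delta> b * a) + a * L b - scale \<xi> (b * L a))"

definition generalized_xi_Lie_derivation ::
    "('f \<Rightarrow> 'a \<Rightarrow> 'a) \<Rightarrow> 'f \<Rightarrow> ('a::ring \<Rightarrow> 'a) \<Rightarrow> bool" where
  "generalized_xi_Lie_derivation scale \<xi> \<delta> \<longleftrightarrow> additive \<delta> \<and>
    (\<exists>L. relating_xi_Lie_derivation scale \<xi> \<delta> L)"

text \<open>In the next two definitions the target algebra is the subring \<open>R\<close> of the ambient ring \<open>'r\<close>,
  and it contains \<open>'a\<close> via the embedding \<open>\<iota>\<close>.\<close>

definition derivation_into :: "('a::ring \<Rightarrow> 'r::ring) \<Rightarrow> 'r set \<Rightarrow> ('a \<Rightarrow> 'r) \<Rightarrow> bool" where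
  "derivation_into \<iota> R \<tau> \<longleftrightarrow> additive \<tau> \<and> range \<tau> \<subseteq> R \<and>
    (\<forall>a b. \<tau> (a * b) = \<tau> a * \<iota> b + \<iota> a * \<tau> b)"

definition generalized_derivation_into ::
    "('a::ring \<Rightarrow> 'r::ring) \<Rightarrow> 'r set \<Rightarrow> ('a \<Rightarrow> 'r) \<Rightarrow> bool" where
  "generalized_derivation_into \<iota> R \<delta> \<longleftrightarrow> additive \<delta> \<and> range \<delta> \<subseteq> R \<and>
    (\<exists>\<tau>. derivation_into \<iota> R \<tau> \<and> (\<forall>a b. \<delta> (a * b) = \<delta> a * \<iota> b + \<iota> a * \<tau> b))"

abbreviation generalized_derivation :: "('a::ring \<Rightarrow> 'a) \<Rightarrow> bool" where
  "generalized_derivation \<equiv> generalized_derivation_into (\<lambda>a. a) UNIV"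

end

theory Submission
  imports Defs
begin

text \<open>
  Comparing the defining identities of \<open>\<delta>\<close> and \<open>L\<close> at the unit gives \<open>\<delta> a = L a + s a\<close> with
  \<open>s = \<delta> 1 - L 1\<close>, so only the \<open>\<xi>\<close>-Lie derivation \<open>L\<close> matters.

  For \<open>\<xi> = - 1\<close> it is a Jordan derivation, hence a derivation by Herstein's theorem (proved
  as by Bresar and Vukman).
  For \<open>\<xi> \<noteq> 1, - 1\<close> the element \<open>c = L 1\<close> is central and
  \<open>(1 + \<xi>) (L (a b) - L a b - a L b) = - c (b a + \<xi> a b)\<close>. The cocycle identity of the left-hand side
  yields \<open>c [[a, x], b] = 0\<close>, so \<open>c = 0\<close> because a ring with a nontrivial idempotent is not commutative.

  For \<open>\<xi> = 1\<close> choose \<open>t\<close> such that \<open>1, t, t\<^sup>2\<close> are independent over the extended centroid. The function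
  \<open>\<phi> y = L (t y) - L t y - t L y\<close> satisfies a functional identity in two variables. Replacing \<open>y\<close> by
  \<open>y t\<close> and \<open>t y\<close> and subtracting turns it into generalized polynomial identities of degree one, which
  are solved by comparing coefficients of the powers of \<open>t\<close> (Martindale). The solution is the central
  map \<open>h\<close> for which \<open>L - h\<close> is a derivation.
\<close>

section \<open>Rings of quotients\<close>

lemma to_qmr_zero: "to_qmr 0 = 0"
  using to_qmr_add[of 0 0] by simp

lemma to_qmr_minus: "to_qmr (- a) = - to_qmr a"
  using to_qmr_add[of a "- a"] by (simp add: to_qmr_zero eq_neg_iff_add_eq_0 add.commute)

lemma to_qmr_diff: "to_qmr (a - b) = to_qmr a - to_qmr b"
  using to_qmr_add[of a "- b"] by (simp add: to_qmr_minus)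

lemma to_qmr_eq_iff: "to_qmr a = to_qmr b \<longleftrightarrow> a = b"
  using inj_to_qmr by (auto dest: injD)

lemma to_qmr_eq_0_iff: "to_qmr a = 0 \<longleftrightarrow> a = 0"
  using to_qmr_eq_iff[of a 0] by (simp add: to_qmr_zero)

lemmas to_qmr_simps = to_qmr_add to_qmr_mult to_qmr_one to_qmr_zero to_qmr_minus to_qmr_diff

lemma dense_right_ideal_annihilator:
  assumes "dense_right_ideal D" "\<And>x. x \<in> D \<Longrightarrow> a * x = 0"
  shows "a = 0"
proof (rule ccontr)
  assume "a \<noteq> 0"
  then obtain r where "a * r \<noteq> 0" "1 * r \<in> D"
    using assms(1) unfolding dense_right_ideal_def by blast
  with assms(2) show False by simp
qed

text \<open>For a representing pair \<open>(D, f)\<close> and \<open>x\<close> in \<open>D\<close>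
  one has \<open>f (x * y) = f x * y\<close>, so \<open>q\<close> composed with left multiplication
  by \<open>x\<close> is left multiplication by \<open>f x\<close>.\<close>

lemma qmr_represented:
  fixes q :: "'a::ring_1 qmr"
  obtains D f where "dense_right_ideal D" "right_module_hom_on D f"
    "\<And>x. x \<in> D \<Longrightarrow> q * to_qmr x = to_qmr (f x)"
proof -
  have "\<exists>p. qmr_repr p \<and> (\<forall>x\<in>fst p. q * to_qmr x = to_qmr (snd p x))"
  proof transfer
    fix q :: "'a set \<times> ('a \<Rightarrow> 'a)"
    assume "qmr_rel q q"
    hence q: "qmr_repr q" by (rule qmr_rel_reprD)
    have "qmr_rel (qmr_times q (left_mult x)) (left_mult (snd q x))" if "x \<in> fst q" for x
      using q that
      by (intro qmr_relI repr_intros)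
        (auto simp: qmr_times_def left_mult_def qmr_repr_def right_module_hom_on_def)
    with q show "\<exists>p. qmr_repr p \<and>
        (\<forall>x\<in>fst p. qmr_rel (qmr_times q (left_mult x)) (left_mult (snd p x)))"
      by blast
  qed
  with that show ?thesis by (auto simp: qmr_repr_def)
qed

lemma qmr_of_hom:
  fixes f :: "'a::ring_1 \<Rightarrow> 'a"
  assumes "dense_right_ideal D" "right_module_hom_on D f"
  obtains q where "\<And>x. x \<in> D \<Longrightarrow> q * to_qmr x = to_qmr (f x)"
proof -
  have "\<exists>q. \<forall>x\<in>D. q * to_qmr x = to_qmr (f x)"
  proof (transfer fixing: D f)
    have q: "qmr_repr (D, f)" using assms by (simp add: qmr_repr_def)
    moreover have "qmr_rel (qmr_times (D, f) (left_mult x)) (left_mult (f x))" if "x \<in> D" for x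
      using q that
      by (intro qmr_relI repr_intros)
        (auto simp: qmr_times_def left_mult_def qmr_repr_def right_module_hom_on_def)
    ultimately show "\<exists>q\<in>{p. qmr_rel p p}.
        \<forall>x\<in>D. qmr_rel (qmr_times q (left_mult x)) (left_mult (f x))"
      using qmr_rel_refl by blast
  qed
  with that show ?thesis by blast
qed

text \<open>On the part of \<open>D\<close> inside the domain of \<open>q\<close>, each value of
  \<open>q\<close> is annihilated by a dense right ideal, hence zero.\<close>

lemma qmr_eq_0I:
  fixes q :: "'a::ring_1 qmr"
  assumes "dense_right_ideal D" "\<And>x. x \<in> D \<Longrightarrow> q * to_qmr x = 0"
  shows "q = 0"
  using assms
proof (transfer fixing: D)
  fix q :: "'a set \<times> ('a \<Rightarrow> 'a)"
  assume "qmr_rel q q" and D: "dense_right_ideal D"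
    and 0: "\<And>x. x \<in> D \<Longrightarrow> qmr_rel (qmr_times q (left_mult x)) (left_mult 0)"
  hence q: "qmr_repr q" by (blast dest: qmr_rel_reprD)
  have "snd q x = 0" if x: "x \<in> D \<inter> fst q" for x
  proof -
    obtain K where K: "dense_right_ideal K" "\<forall>y\<in>K. snd q (x * y) = 0"
      using 0[of x] x by (auto simp: qmr_rel_def qmr_times_def left_mult_def)
    have "snd q x * y = 0" if "y \<in> K" for y
      using K(2) that q x by (auto simp: qmr_repr_def right_module_hom_on_def)
    with K(1) show ?thesis by (rule dense_right_ideal_annihilator)
  qed
  thus "qmr_rel q (left_mult 0)"
    using q D unfolding qmr_rel_def
    by (intro conjI repr_left_mult exI[of _ "D \<inter> fst q"])
      (auto simp: left_mult_def qmr_repr_def intro: dense_Int)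
qed

lemma qmr_common_denominator:
  fixes p q :: "'a::ring_1 qmr"
  assumes "p \<noteq> 0"
  obtains x y z where "p * to_qmr x = to_qmr y" "y \<noteq> 0" "q * to_qmr x = to_qmr z"
proof -
  obtain D f where D: "dense_right_ideal D" "\<And>x. x \<in> D \<Longrightarrow> p * to_qmr x = to_qmr (f x)"
    by (rule qmr_represented[of p]) blast
  obtain E g where E: "dense_right_ideal E" "\<And>x. x \<in> E \<Longrightarrow> q * to_qmr x = to_qmr (g x)"
    by (rule qmr_represented[of q]) blast
  obtain x where x: "x \<in> D \<inter> E" "p * to_qmr x \<noteq> 0"
    using qmr_eq_0I[OF dense_Int[OF D(1) E(1)], of p] assms by blast
  show ?thesis
    using that[of x "f x" "g x"] x D(2)[of x] E(2)[of x] by (auto simp: to_qmr_eq_0_iff)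
qed

text \<open>If \<open>x\<close> and \<open>p * to_qmr x\<close> both come from the ring,
  \<open>q\<close> commutes with both; so \<open>q * p - p * q\<close> annihilates a dense right
  ideal.\<close>

lemma centralizer_to_qmr:
  fixes q :: "'a::ring_1 qmr"
  assumes "\<And>x. q * to_qmr x = to_qmr x * q"
  shows "q \<in> center"
proof -
  have "q * p = p * q" for p
  proof -
    obtain D f where D: "dense_right_ideal D" "\<And>x. x \<in> D \<Longrightarrow> p * to_qmr x = to_qmr (f x)"
      by (rule qmr_represented[of p]) blast
    have "(q * p - p * q) * to_qmr x = 0" if "x \<in> D" for x
    proof -
      have "q * (p * to_qmr x) = (p * to_qmr x) * q"
        using D(2)[OF that] assms by simp
      thus ?thesis by (simp add: left_diff_distrib mult.assoc assms)
    qed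
    from qmr_eq_0I[OF D(1) this] show ?thesis by simp
  qed
  thus ?thesis by (simp add: center_def)
qed

section \<open>The center as a scalar ring\<close>

lemma centerI: "(\<And>x. z * x = x * z) \<Longrightarrow> z \<in> center"
  by (simp add: center_def)

lemma centerD: "z \<in> center \<Longrightarrow> z * x = x * z"
  by (simp add: center_def)

lemma center_closed:
  assumes z: "z \<in> center" and w: "w \<in> center"
  shows "z + w \<in> center" "z - w \<in> center" "- z \<in> center" "z * w \<in> center"
proof -
  show "z + w \<in> center"
    by (rule centerI) (simp only: distrib_left distrib_right centerD[OF z] centerD[OF w])
  show "z - w \<in> center"
    by (rule centerI)
      (simp only: left_diff_distrib right_diff_distrib centerD[OF z] centerD[OF w])
  show "- z \<in> center"
    by (rule centerI) (simp only: mult_minus_left mult_minus_right centerD[OF z])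
  show "z * w \<in> center"
  proof (rule centerI)
    fix x
    have "z * w * x = z * (x * w)" by (simp only: mult.assoc centerD[OF w])
    also have "\<dots> = x * (z * w)" by (metis centerD[OF z] mult.assoc)
    finally show "z * w * x = x * (z * w)" .
  qed
qed

text \<open>As a type, the center can be the scalar ring of the \<open>module\<close> locale, which
  provides \<open>cent.span\<close>. Cancellation of scalars comes later, from primeness, in
  \<open>cscale_eq_0_iff\<close>.\<close>

typedef (overloaded) 'r cent = "center :: 'r::ring_1 set"
  by (rule exI[of _ 0]) (rule centerI, simp)

setup_lifting type_definition_cent

instantiation cent :: (ring_1) comm_ring_1
begin

lift_definition zero_cent :: "'a cent" is 0 by (rule centerI) simp
lift_definition one_cent :: "'a cent" is 1 by (rule centerI) simp
lift_definition plus_cent :: "'a cent \<Rightarrow> 'a cent \<Rightarrow> 'a cent" is "(+)"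
  by (rule center_closed)
lift_definition minus_cent :: "'a cent \<Rightarrow> 'a cent \<Rightarrow> 'a cent" is "(-)"
  by (rule center_closed)
lift_definition uminus_cent :: "'a cent \<Rightarrow> 'a cent" is uminus
  by (rule center_closed)
lift_definition times_cent :: "'a cent \<Rightarrow> 'a cent \<Rightarrow> 'a cent" is "(*)"
  by (rule center_closed)

instance
proof
  fix a b c :: "'a cent"
  show "a * b * c = a * (b * c)" by transfer (rule mult.assoc)
  show "a * b = b * a" by transfer (rule centerD)
  show "1 * a = a" by transfer simp
  show "(a + b) * c = a * c + b * c" by transfer (rule distrib_right)
  show "a + b + c = a + (b + c)" by transfer (rule add.assoc)
  show "a + b = b + a" by transfer (rule add.commute)
  show "0 + a = a" by transfer simp
  show "- a + a = 0" by transfer simp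
  show "a - b = a + - b" by transfer simp
  show "(0 :: 'a cent) \<noteq> 1" by transfer simp
qed

end

definition cscale :: "'r::ring_1 cent \<Rightarrow> 'r \<Rightarrow> 'r"  (infixr \<open>\<cdot>\<close> 75)
  where "c \<cdot> x = Rep_cent c * x"

interpretation cent: module "cscale :: 'r::ring_1 cent \<Rightarrow> 'r \<Rightarrow> 'r"
  by standard (simp_all add: cscale_def plus_cent.rep_eq times_cent.rep_eq one_cent.rep_eq
      algebra_simps)

lemma Rep_cent_commute: "x * Rep_cent c = Rep_cent c * x"
  using centerD[OF Rep_cent[of c]] by simp

lemma cscale_mult_left [simp]: "c \<cdot> x * y = c \<cdot> (x * y)"
  by (simp add: cscale_def mult.assoc)

lemma cscale_mult_right [simp]: "x * c \<cdot> y = c \<cdot> (x * y)"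
  unfolding cscale_def by (metis Rep_cent_commute mult.assoc)

lemma Rep_cent_eq_0_iff: "Rep_cent c = 0 \<longleftrightarrow> c = 0"
  by (metis Rep_cent_inject zero_cent.rep_eq)

lemma cscale_one: "c \<cdot> 1 = Rep_cent c"
  by (simp add: cscale_def)

lemma cscale_Abs: "z \<in> center \<Longrightarrow> Abs_cent z \<cdot> x = z * x"
  by (simp add: cscale_def Abs_cent_inverse)

section \<open>Generalized polynomial identities of degree one\<close>

text \<open>These operators form the algebra generated by left and right multiplications by ring
  elements; appending lists adds operators.\<close>

definition mult_op :: "('a \<times> 'a) list \<Rightarrow> 'a::ring_1 qmr \<Rightarrow> 'a qmr" where
  "mult_op ps q = (\<Sum>(l, r)\<leftarrow>ps. to_qmr l * q * to_qmr r)"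

lemma mult_op_Nil [simp]: "mult_op [] q = 0"
  by (simp add: mult_op_def)

lemma mult_op_Cons [simp]: "mult_op ((l, r) # ps) q = to_qmr l * q * to_qmr r + mult_op ps q"
  by (simp add: mult_op_def)

lemma mult_op_append: "mult_op (ps @ qs) q = mult_op ps q + mult_op qs q"
  by (simp add: mult_op_def)

lemma mult_op_diff: "mult_op ps (p - q) = mult_op ps p - mult_op ps q"
  by (induction ps) (auto simp: algebra_simps)

lemma mult_op_cscale: "mult_op ps (c \<cdot> q) = c \<cdot> mult_op ps q"
  by (induction ps) (auto simp: cent.scale_right_distrib)

lemma mult_op_map_left: "mult_op (map (\<lambda>(l, r). (a * l, r)) ps) q = to_qmr a * mult_op ps q"
  by (induction ps) (auto simp: algebra_simps to_qmr_mult)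

lemma mult_op_map_right: "mult_op (map (\<lambda>(l, r). (l, r * a)) ps) q = mult_op ps q * to_qmr a"
  by (induction ps) (auto simp: algebra_simps to_qmr_mult)

text \<open>Substituting \<open>r * x\<close> for \<open>x\<close> and multiplying by
  \<open>l\<close> on the left turns each left factor \<open>p\<close> into \<open>l p r\<close>;
  such consequences are summed.\<close>

lemma gpi_mult_op_left:
  assumes "\<And>x. (\<Sum>(p, q)\<leftarrow>gs. p * to_qmr x * q) = 0"
  shows "(\<Sum>(p, q)\<leftarrow>gs. mult_op ps p * to_qmr x * q) = 0"
proof (induction ps)
  case Nil
  show ?case by (induction gs) auto
next
  case (Cons lr ps)
  obtain l r where lr: "lr = (l, r)" by force
  have "(\<Sum>(p, q)\<leftarrow>gs. mult_op (lr # ps) p * to_qmr x * q) =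
      to_qmr l * (\<Sum>(p, q)\<leftarrow>gs. p * to_qmr (r * x) * q) +
      (\<Sum>(p, q)\<leftarrow>gs. mult_op ps p * to_qmr x * q)"
    by (induction gs) (auto simp: lr algebra_simps to_qmr_mult)
  with Cons assms show ?case by simp
qed

lemma gpi_mult_op_right:
  assumes "\<And>x. (\<Sum>(p, q)\<leftarrow>gs. p * to_qmr x * q) = 0"
  shows "(\<Sum>(p, q)\<leftarrow>gs. p * to_qmr x * mult_op ps q) = 0"
proof (induction ps)
  case Nil
  show ?case by (induction gs) auto
next
  case (Cons lr ps)
  obtain l r where lr: "lr = (l, r)" by force
  have "(\<Sum>(p, q)\<leftarrow>gs. p * to_qmr x * mult_op (lr # ps) q) =
      (\<Sum>(p, q)\<leftarrow>gs. p * to_qmr (x * l) * q) * to_qmr r +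
      (\<Sum>(p, q)\<leftarrow>gs. p * to_qmr x * mult_op ps q)"
    by (induction gs) (auto simp: lr algebra_simps to_qmr_mult)
  with Cons assms show ?case by simp
qed

section \<open>Prime rings: bimodule maps and independence over the extended centroid\<close>

locale prime_ring =
  fixes ring_type :: "'a::ring_1 itself"
  assumes prime: "(\<And>x. a * x * b = 0) \<Longrightarrow> a = 0 \<or> b = (0::'a)"
begin

lemma dense_ideal:
  fixes I :: "'a set"
  assumes I: "right_ideal I" and left: "\<And>a x. x \<in> I \<Longrightarrow> a * x \<in> I" and z: "z \<in> I" "z \<noteq> 0"
  shows "dense_right_ideal I"
  unfolding dense_right_ideal_def
proof (intro conjI I allI impI)
  fix a b :: 'a
  assume "a \<noteq> 0"
  then obtain x where "a * x * z \<noteq> 0" using prime z(2) by blast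
  with left z(1) show "\<exists>r. a * r \<noteq> 0 \<and> b * r \<in> I"
    by (intro exI[of _ "x * z"]) (simp add: mult.assoc)
qed

text \<open>Denominators \<open>s\<close> of \<open>p\<close> and \<open>r\<close> of
  \<open>q\<close> are cleared on the right; \<open>s\<close> is absorbed by replacing
  \<open>x\<close> by \<open>s * x\<close>.\<close>

lemma qmr_prime:
  fixes p q :: "'a qmr"
  assumes "\<And>x. p * to_qmr x * q = 0"
  shows "p = 0 \<or> q = 0"
proof (rule ccontr)
  assume "\<not> (p = 0 \<or> q = 0)"
  hence p: "p \<noteq> 0" and q: "q \<noteq> 0" by auto
  obtain s u where s: "p * to_qmr s = to_qmr u" "u \<noteq> 0"
    by (rule qmr_common_denominator[OF p, of 0])
  obtain r y where r: "q * to_qmr r = to_qmr y" "y \<noteq> 0"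
    by (rule qmr_common_denominator[OF q, of 0])
  have "u * x * y = 0" for x
  proof -
    have "to_qmr (u * x * y) = p * to_qmr s * to_qmr x * (q * to_qmr r)"
      by (simp add: to_qmr_mult s r)
    also have "\<dots> = p * to_qmr (s * x) * q * to_qmr r"
      by (simp add: to_qmr_mult mult.assoc)
    finally show ?thesis using assms by (simp add: to_qmr_eq_0_iff)
  qed
  with s r prime show False by blast
qed

lemma cscale_eq_0_iff: "c \<cdot> (q :: 'a qmr) = 0 \<longleftrightarrow> c = 0 \<or> q = 0"
proof
  assume cq: "c \<cdot> q = 0"
  have "Rep_cent c * to_qmr x * q = 0" for x
  proof -
    have "Rep_cent c * to_qmr x * q = to_qmr x * c \<cdot> q"
      unfolding cscale_def by (metis Rep_cent_commute mult.assoc)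
    with cq show ?thesis by simp
  qed
  thus "c = 0 \<or> q = 0" using qmr_prime Rep_cent_eq_0_iff by blast
qed auto

text \<open>\<open>G\<close> is the graph of a bimodule homomorphism from a sub-bimodule of the ring of quotients.\<close>

lemma bimodule_hom_central:
  fixes G :: "('a qmr \<times> 'a qmr) set"
  assumes add: "\<And>p p' q q'. (p, p') \<in> G \<Longrightarrow> (q, q') \<in> G \<Longrightarrow> (p + q, p' + q') \<in> G"
    and left: "\<And>a p p'. (p, p') \<in> G \<Longrightarrow> (to_qmr a * p, to_qmr a * p') \<in> G"
    and right: "\<And>a p p'. (p, p') \<in> G \<Longrightarrow> (p * to_qmr a, p' * to_qmr a) \<in> G"
    and single: "\<And>q. (0, q) \<in> G \<Longrightarrow> q = 0"
  obtains c where "\<And>p p'. (p, p') \<in> G \<Longrightarrow> p' = c \<cdot> p"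
proof (cases "\<exists>p p'. (p, p') \<in> G \<and> p \<noteq> 0")
  case False
  with single that[of 0] show ?thesis by fastforce
next
  case True
  then obtain p p' where p: "(p, p') \<in> G" "p \<noteq> 0" by blast
  have unique: "q' = q''" if "(q, q') \<in> G" "(q, q'') \<in> G" for q q' q''
  proof -
    have "(to_qmr (- 1) * q, to_qmr (- 1) * q'') \<in> G" using left that(2) .
    from add[OF that(1) this] single[of "q' - q''"] show ?thesis
      by (simp add: to_qmr_minus to_qmr_one)
  qed
  \<comment> \<open>\<open>G\<close> restricts to a bimodule map \<open>f\<close> from a two-sided
    ideal \<open>I\<close> of the ring to the ring.\<close>
  define I where "I = {x. \<exists>y. (to_qmr x, to_qmr y) \<in> G}"
  define f where "f x = (SOME y. (to_qmr x, to_qmr y) \<in> G)" for x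
  have f: "(to_qmr x, to_qmr (f x)) \<in> G" if "x \<in> I" for x
    using that unfolding I_def f_def by (auto intro: someI)
  have fI: "x \<in> I \<and> f x = y" if "(to_qmr x, to_qmr y) \<in> G" for x y
    using that f[of x] unique[of "to_qmr x" "to_qmr y" "to_qmr (f x)"]
    by (auto simp: I_def to_qmr_eq_iff)
  have I_add: "x + y \<in> I \<and> f (x + y) = f x + f y" if "x \<in> I" "y \<in> I" for x y
    using fI[of "x + y" "f x + f y"] add[OF f[OF that(1)] f[OF that(2)]] by (simp add: to_qmr_add)
  have I_right: "x * a \<in> I \<and> f (x * a) = f x * a" if "x \<in> I" for x a
    using fI[of "x * a" "f x * a"] right[OF f[OF that]] by (simp add: to_qmr_mult)
  have I_left: "a * x \<in> I \<and> f (a * x) = a * f x" if "x \<in> I" for x a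
    using fI[of "a * x" "a * f x"] left[OF f[OF that]] by (simp add: to_qmr_mult)
  \<comment> \<open>Clearing denominators gives a nonzero element of \<open>I\<close>, so
    \<open>I\<close> is dense and \<open>f\<close> is left multiplication by some \<open>c\<close>.
    As \<open>f\<close> respects left multiplication too, \<open>c\<close> is central.\<close>
  obtain x y z where x: "p * to_qmr x = to_qmr y" "y \<noteq> 0" "p' * to_qmr x = to_qmr z"
    by (rule qmr_common_denominator[OF p(2)])
  have y: "y \<in> I" using fI[of y z] right[OF p(1), of x] x by simp
  have "right_ideal I"
    unfolding right_ideal_def using I_add I_right I_right[OF y, of 0] by auto
  hence dense: "dense_right_ideal I" using I_left y x(2) by (intro dense_ideal) auto
  moreover have "right_module_hom_on I f"
    unfolding right_module_hom_on_def using I_add I_right by blast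
  ultimately obtain c where c: "\<And>x. x \<in> I \<Longrightarrow> c * to_qmr x = to_qmr (f x)"
    using qmr_of_hom by blast
  have "c * to_qmr a = to_qmr a * c" for a
  proof -
    have "(c * to_qmr a - to_qmr a * c) * to_qmr x = 0" if "x \<in> I" for x
    proof -
      have "c * to_qmr (a * x) = to_qmr a * (c * to_qmr x)"
        using c[of "a * x"] I_left[OF that, of a] by (simp add: to_qmr_mult c[OF that])
      thus ?thesis by (simp add: left_diff_distrib mult.assoc to_qmr_mult)
    qed
    from qmr_eq_0I[OF dense this] show ?thesis by simp
  qed
  hence center: "c \<in> center" by (rule centralizer_to_qmr)
  show ?thesis
  proof (rule that[of "Abs_cent c"])
    fix q q'
    assume q: "(q, q') \<in> G"
    obtain D g where D: "dense_right_ideal D" "\<And>x. x \<in> D \<Longrightarrow> q * to_qmr x = to_qmr (g x)"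
      by (rule qmr_represented[of q]) blast
    obtain E h where E: "dense_right_ideal E" "\<And>x. x \<in> E \<Longrightarrow> q' * to_qmr x = to_qmr (h x)"
      by (rule qmr_represented[of q']) blast
    have "(q' - c * q) * to_qmr x = 0" if "x \<in> D \<inter> E" for x
    proof -
      have "(to_qmr (g x), to_qmr (h x)) \<in> G"
        using right[OF q, of x] D(2)[of x] E(2)[of x] that by simp
      from fI[OF this] c[of "g x"] show ?thesis
        using D(2)[of x] E(2)[of x] that by (simp add: left_diff_distrib mult.assoc)
    qed
    from qmr_eq_0I[OF dense_Int[OF D(1) E(1)] this] show "q' = Abs_cent c \<cdot> q"
      by (simp add: cscale_Abs[OF center])
  qed
qed

text \<open>If no operator separated \<open>a\<close> from \<open>insert b S\<close>, then among
  operators killing \<open>S\<close> the value at \<open>b\<close> would determine the value at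
  \<open>a\<close>. This is a bimodule map, hence scaling by some \<open>c\<close>, so these
  operators also kill \<open>a - c \<cdot> b\<close>, against the induction hypothesis.\<close>

lemma separating_mult_op:
  fixes a :: "'a qmr"
  assumes "finite S" "a \<notin> cent.span S"
  shows "\<exists>ps. mult_op ps a \<noteq> 0 \<and> (\<forall>b\<in>S. mult_op ps b = 0)"
  using assms
proof (induction S arbitrary: a rule: finite_induct)
  case empty
  thus ?case by (intro exI[of _ "[(1, 1)]"]) (simp add: to_qmr_one)
next
  case (insert b S)
  show ?case
  proof (rule ccontr)
    assume contr: "\<not> (\<exists>ps. mult_op ps a \<noteq> 0 \<and> (\<forall>c\<in>insert b S. mult_op ps c = 0))"
    define G where "G = {(mult_op ps b, mult_op ps a) | ps. \<forall>c\<in>S. mult_op ps c = 0}"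
    obtain c where c: "\<And>p p'. (p, p') \<in> G \<Longrightarrow> p' = c \<cdot> p"
    proof (rule bimodule_hom_central[of G])
      fix p p' q q'
      assume "(p, p') \<in> G" "(q, q') \<in> G"
      then obtain ps qs where "\<forall>c\<in>S. mult_op ps c = 0" "\<forall>c\<in>S. mult_op qs c = 0"
        "p = mult_op ps b" "p' = mult_op ps a" "q = mult_op qs b" "q' = mult_op qs a"
        by (auto simp: G_def)
      thus "(p + q, p' + q') \<in> G"
        unfolding G_def by (intro CollectI exI[of _ "ps @ qs"]) (simp add: mult_op_append)
    next
      fix e p p'
      assume "(p, p') \<in> G"
      then obtain ps where ps: "\<forall>c\<in>S. mult_op ps c = 0" "p = mult_op ps b" "p' = mult_op ps a"
        by (auto simp: G_def)
      show "(to_qmr e * p, to_qmr e * p') \<in> G"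
        unfolding G_def using ps
        by (intro CollectI exI[of _ "map (\<lambda>(l, r). (e * l, r)) ps"]) (simp add: mult_op_map_left)
      show "(p * to_qmr e, p' * to_qmr e) \<in> G"
        unfolding G_def using ps
        by (intro CollectI exI[of _ "map (\<lambda>(l, r). (l, r * e)) ps"]) (simp add: mult_op_map_right)
    next
      fix q
      assume "(0, q) \<in> G"
      with contr show "q = 0" by (force simp: G_def)
    qed blast
    have "a - c \<cdot> b \<notin> cent.span S"
      using insert.prems by (auto simp: cent.span_insert)
    then obtain ps where "mult_op ps (a - c \<cdot> b) \<noteq> 0" "\<forall>c\<in>S. mult_op ps c = 0"
      using insert.IH by blast
    with c[of "mult_op ps b" "mult_op ps a"] show False
      by (auto simp: G_def mult_op_diff mult_op_cscale)
  qed
qed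

text \<open>An operator that kills every \<open>s\<close> but not \<open>q\<close>, applied to the
  right factors, leaves a single term, to which primeness applies.\<close>

lemma gpi_right_coeff:
  fixes c q :: "'a qmr"
  assumes gpi: "\<And>x. c * to_qmr x * q + (\<Sum>(p, s)\<leftarrow>gs. p * to_qmr x * s) = 0"
    and q: "q \<notin> cent.span (snd ` set gs)"
  shows "c = 0"
proof -
  obtain ps where ps: "mult_op ps q \<noteq> 0" "\<forall>s\<in>snd ` set gs. mult_op ps s = 0"
    using separating_mult_op[OF _ q] by auto
  have zero: "(\<Sum>(p, s)\<leftarrow>gs. p * to_qmr x * mult_op ps s) = 0" for x
    using ps(2) by (induction gs) auto
  have "c * to_qmr x * mult_op ps q = 0" for x
    using gpi_mult_op_right[where gs = "(c, q) # gs" and x = x and ps = ps] gpi zero by simp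
  with ps(1) show ?thesis using qmr_prime by blast
qed

lemma gpi_left_coeff:
  fixes c q :: "'a qmr"
  assumes gpi: "\<And>x. q * to_qmr x * c + (\<Sum>(s, p)\<leftarrow>gs. s * to_qmr x * p) = 0"
    and q: "q \<notin> cent.span (fst ` set gs)"
  shows "c = 0"
proof -
  obtain ps where ps: "mult_op ps q \<noteq> 0" "\<forall>s\<in>fst ` set gs. mult_op ps s = 0"
    using separating_mult_op[OF _ q] by auto
  have zero: "(\<Sum>(s, p)\<leftarrow>gs. mult_op ps s * to_qmr x * p) = 0" for x
    using ps(2) by (induction gs) auto
  have "mult_op ps q * to_qmr x * c = 0" for x
    using gpi_mult_op_left[where gs = "(q, c) # gs" and x = x and ps = ps] gpi zero by simp
  with ps(1) show ?thesis using qmr_prime by blast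
qed

end

section \<open>Identities with an element that is not quadratic\<close>

locale nonquadratic = prime_ring ring_type for ring_type :: "'a::ring_1 itself" +
  fixes t :: 'a
  assumes nonquadratic: "to_qmr t * to_qmr t \<notin> cent.span {1, to_qmr t}"
begin

abbreviation T :: "'a qmr" where "T \<equiv> to_qmr t"

lemma T_notin_span: "T \<notin> cent.span {1}"
proof
  assume "T \<in> cent.span {1}"
  then obtain c where "T = c \<cdot> 1" by (auto simp: cent.span_insert)
  hence "T * T = c \<cdot> T" by (metis cscale_mult_left mult_1)
  hence "T * T \<in> cent.span {1, T}" by (simp add: cent.span_scale cent.span_base)
  with nonquadratic show False by contradiction
qed

lemma gpi_right_coeffs:
  assumes gpi: "\<And>x. c2 * to_qmr x * (T * T) + c1 * to_qmr x * T + c0 * to_qmr x = 0"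
  shows "c2 = 0" "c1 = 0" "c0 = 0"
proof -
  show c2: "c2 = 0"
    using gpi_right_coeff[of c2 "T * T" "[(c1, T), (c0, 1)]"] gpi nonquadratic
    by (simp add: insert_commute add.assoc)
  show c1: "c1 = 0"
    using gpi_right_coeff[of c1 T "[(c0, 1)]"] gpi T_notin_span c2 by simp
  show "c0 = 0"
    using gpi[of 1] c1 c2 by (simp add: to_qmr_one)
qed

lemma gpi_left_coeffs:
  assumes gpi: "\<And>x. T * T * to_qmr x * c2 + T * to_qmr x * c1 + to_qmr x * c0 = 0"
  shows "c2 = 0" "c1 = 0" "c0 = 0"
proof -
  show c2: "c2 = 0"
    using gpi_left_coeff[of "T * T" c2 "[(T, c1), (1, c0)]"] gpi nonquadratic
    by (simp add: insert_commute add.assoc)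
  show c1: "c1 = 0"
    using gpi_left_coeff[of T c1 "[(1, c0)]"] gpi T_notin_span c2 by simp
  show "c0 = 0"
    using gpi[of 1] c1 c2 by (simp add: to_qmr_one)
qed

text \<open>Multiplied by \<open>to_qmr x\<close> on the left, the relation becomes an identity in
  \<open>x\<close> with central coefficients.\<close>

lemma independent_powers:
  assumes "a \<cdot> 1 + b \<cdot> T + c \<cdot> (T * T) = 0"
  shows "a = 0" "b = 0" "c = 0"
proof -
  have "c \<cdot> 1 * to_qmr x * (T * T) + b \<cdot> 1 * to_qmr x * T + a \<cdot> 1 * to_qmr x =
      to_qmr x * (a \<cdot> 1 + b \<cdot> T + c \<cdot> (T * T))" for x
    by (simp add: algebra_simps)
  hence "c \<cdot> 1 * to_qmr x * (T * T) + b \<cdot> 1 * to_qmr x * T + a \<cdot> 1 * to_qmr x = 0" for x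
    by (simp only: assms mult_zero_right)
  from gpi_right_coeffs[OF this] show "a = 0" "b = 0" "c = 0"
    by (simp_all add: cscale_eq_0_iff)
qed

text \<open>The powers up to \<open>T\<^sup>3\<close> may be dependent; \<open>\<alpha>\<close> is the coefficient of \<open>T\<^sup>2\<close> in \<open>T\<^sup>3\<close> if
  they are, and arbitrary otherwise.\<close>

lemma gpi_cubic:
  obtains \<alpha> where
    "\<And>c0 c1 c2 c3. (\<And>x. c3 * to_qmr x * (T * (T * T)) + c2 * to_qmr x * (T * T) +
        c1 * to_qmr x * T + c0 * to_qmr x = 0) \<Longrightarrow> c2 + \<alpha> \<cdot> c3 = 0"
    "\<And>c0 c1 c2 c3. (\<And>x. T * (T * T) * to_qmr x * c3 + T * T * to_qmr x * c2 +
        T * to_qmr x * c1 + to_qmr x * c0 = 0) \<Longrightarrow> c2 + \<alpha> \<cdot> c3 = 0"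
proof (cases "T * (T * T) \<in> cent.span {1, T, T * T}")
  case True
  then obtain \<gamma> \<beta> \<alpha> where "T * (T * T) - \<gamma> \<cdot> 1 - \<beta> \<cdot> T = \<alpha> \<cdot> (T * T)"
    by (auto simp: cent.span_insert)
  hence cube: "T * (T * T) = \<alpha> \<cdot> (T * T) + \<beta> \<cdot> T + \<gamma> \<cdot> 1"
    by (simp add: algebra_simps)
  show ?thesis
  proof (rule that)
    fix c0 c1 c2 c3
    assume gpi: "\<And>x. c3 * to_qmr x * (T * (T * T)) + c2 * to_qmr x * (T * T) +
        c1 * to_qmr x * T + c0 * to_qmr x = 0"
    show "c2 + \<alpha> \<cdot> c3 = 0"
    proof (rule gpi_right_coeffs(1))
      fix x
      show "(c2 + \<alpha> \<cdot> c3) * to_qmr x * (T * T) + (c1 + \<beta> \<cdot> c3) * to_qmr x * T +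
          (c0 + \<gamma> \<cdot> c3) * to_qmr x = 0"
        using gpi[of x] unfolding cube by (simp add: algebra_simps)
    qed
  next
    fix c0 c1 c2 c3
    assume gpi: "\<And>x. T * (T * T) * to_qmr x * c3 + T * T * to_qmr x * c2 +
        T * to_qmr x * c1 + to_qmr x * c0 = 0"
    show "c2 + \<alpha> \<cdot> c3 = 0"
    proof (rule gpi_left_coeffs(1))
      fix x
      show "T * T * to_qmr x * (c2 + \<alpha> \<cdot> c3) + T * to_qmr x * (c1 + \<beta> \<cdot> c3) +
          to_qmr x * (c0 + \<gamma> \<cdot> c3) = 0"
        using gpi[of x] unfolding cube by (simp add: algebra_simps)
    qed
  qed
next
  case False
  show ?thesis
  proof (rule that[of 0])
    fix c0 c1 c2 c3
    assume gpi: "\<And>x. c3 * to_qmr x * (T * (T * T)) + c2 * to_qmr x * (T * T) +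
        c1 * to_qmr x * T + c0 * to_qmr x = 0"
    have "c3 = 0"
      using gpi_right_coeff[of c3 "T * (T * T)" "[(c2, T * T), (c1, T), (c0, 1)]"] gpi False
      by (simp add: insert_commute add.assoc)
    with gpi gpi_right_coeffs(1)[of c2 c1 c0] show "c2 + 0 \<cdot> c3 = 0" by simp
  next
    fix c0 c1 c2 c3
    assume gpi: "\<And>x. T * (T * T) * to_qmr x * c3 + T * T * to_qmr x * c2 +
        T * to_qmr x * c1 + to_qmr x * c0 = 0"
    have "c3 = 0"
      using gpi_left_coeff[of "T * (T * T)" c3 "[(T * T, c2), (T, c1), (1, c0)]"] gpi False
      by (simp add: insert_commute add.assoc)
    with gpi gpi_left_coeffs(1)[of c2 c1 c0] show "c2 + 0 \<cdot> c3 = 0" by simp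
  qed
qed

text \<open>An operator killing \<open>1\<close>, \<open>T\<close> and \<open>T * T\<close>, applied
  to the right factors, deletes the right-hand side; \<open>gpi_left_coeffs\<close> shows that it
  kills \<open>c2\<close>, \<open>c1\<close> and \<open>c0\<close> as well.\<close>

lemma gpi_in_span:
  assumes gpi: "\<And>x. T * T * to_qmr x * c2 + T * to_qmr x * c1 + to_qmr x * c0 =
    d2 * to_qmr x * (T * T) + d1 * to_qmr x * T + d0 * to_qmr x"
  shows "c2 \<in> cent.span {1, T, T * T}" "c1 \<in> cent.span {1, T, T * T}"
    "c0 \<in> cent.span {1, T, T * T}"
proof -
  have *: "mult_op ps c2 = 0 \<and> mult_op ps c1 = 0 \<and> mult_op ps c0 = 0"
    if ps: "\<forall>s\<in>{1, T, T * T}. mult_op ps s = 0" for ps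
  proof -
    let ?gs = "[(T * T, c2), (T, c1), (1, c0), (- d2, T * T), (- d1, T), (- d0, 1)]"
    have "(\<Sum>(p, q)\<leftarrow>?gs. p * to_qmr x * q) = 0" for x
      using gpi[of x] by (simp add: algebra_simps)
    from gpi_mult_op_right[OF this, where ps = ps]
    have "T * T * to_qmr x * mult_op ps c2 + T * to_qmr x * mult_op ps c1 +
        to_qmr x * mult_op ps c0 = 0" for x
      using ps by (simp add: add.assoc)
    from gpi_left_coeffs[OF this] show ?thesis by simp
  qed
  have "c \<in> cent.span {1, T, T * T}" if "c \<in> {c2, c1, c0}" for c
  proof (rule ccontr)
    assume "c \<notin> cent.span {1, T, T * T}"
    with separating_mult_op[of "{1, T, T * T}" c]
    obtain ps where "mult_op ps c \<noteq> 0" "\<forall>s\<in>{1, T, T * T}. mult_op ps s = 0"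
      by auto
    with *[of ps] that show False by auto
  qed
  thus "c2 \<in> cent.span {1, T, T * T}" "c1 \<in> cent.span {1, T, T * T}"
    "c0 \<in> cent.span {1, T, T * T}"
    by simp_all
qed

lemma span_powers:
  assumes "x \<in> cent.span {1, T, T * T}"
  obtains a b c where "x = a \<cdot> 1 + b \<cdot> T + c \<cdot> (T * T)"
proof -
  from assms obtain a b c where "x - a \<cdot> 1 - b \<cdot> T = c \<cdot> (T * T)"
    by (auto simp: cent.span_insert)
  hence "x = a \<cdot> 1 + b \<cdot> T + c \<cdot> (T * T)" by (simp add: algebra_simps)
  with that show ?thesis by blast
qed

text \<open>All three are polynomials in \<open>T\<close>, and the identity says that the 3 by 3
  matrix of coefficients of the terms \<open>T^i x T^j\<close> is symmetric.\<close>

lemma gpi_symmetric: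
  assumes gpi: "\<And>x. T * T * to_qmr x * p + T * to_qmr x * q + to_qmr x * r =
    p * to_qmr x * (T * T) + q * to_qmr x * T + r * to_qmr x"
  obtains a b c d e f where
    "p = a \<cdot> 1 + b \<cdot> T + c \<cdot> (T * T)"
    "q = d \<cdot> 1 + e \<cdot> T + b \<cdot> (T * T)"
    "r = f \<cdot> 1 + d \<cdot> T + a \<cdot> (T * T)"
proof -
  obtain p0 p1 p2 where p: "p = p0 \<cdot> 1 + p1 \<cdot> T + p2 \<cdot> (T * T)"
    using span_powers[OF gpi_in_span(1)[OF gpi]] .
  obtain q0 q1 q2 where q: "q = q0 \<cdot> 1 + q1 \<cdot> T + q2 \<cdot> (T * T)"
    using span_powers[OF gpi_in_span(2)[OF gpi]] .
  obtain r0 r1 r2 where r: "r = r0 \<cdot> 1 + r1 \<cdot> T + r2 \<cdot> (T * T)"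
    using span_powers[OF gpi_in_span(3)[OF gpi]] .
  have "T * T * to_qmr x * ((p0 - r2) \<cdot> 1 + (p1 - q2) \<cdot> T + 0 \<cdot> (T * T)) +
      T * to_qmr x * ((q0 - r1) \<cdot> 1 + 0 \<cdot> T + (q2 - p1) \<cdot> (T * T)) +
      to_qmr x * (0 \<cdot> 1 + (r1 - q0) \<cdot> T + (r2 - p0) \<cdot> (T * T)) = 0" for x
    using gpi[of x] unfolding p q r by (simp add: algebra_simps)
  from independent_powers(1,2)[OF gpi_left_coeffs(1)[OF this]]
    independent_powers(1)[OF gpi_left_coeffs(2)[OF this]]
  have "p0 = r2" "p1 = q2" "q0 = r1" by simp_all
  with p q r that show ?thesis by blast
qed

end

section \<open>Lie derivations\<close>

text \<open>\<open>L\<close> has values in the ring of quotients because the central summand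
  \<open>h\<close> to be split off lives there.\<close>

locale lie_derivation = nonquadratic ring_type t for ring_type :: "'a::ring_1 itself" and t :: 'a +
  fixes L :: "'a \<Rightarrow> 'a qmr"
  assumes additive_L: "additive L"
    and Lie: "L (commutator x y) = commutator (L x) (to_qmr y) + commutator (to_qmr x) (L y)"
begin

lemmas L_simps = additive.add[OF additive_L] additive.diff[OF additive_L]
  additive.minus[OF additive_L] additive.zero[OF additive_L]

section \<open>A functional identity for \<open>\<phi>\<close> and the resulting identity for
  \<open>\<psi>\<close>\<close>

definition lie_defect :: "'a \<Rightarrow> 'a \<Rightarrow> 'a qmr" where
  "lie_defect x y = L (x * y) - L (y * x) - L x * to_qmr y + to_qmr y * L x
    - to_qmr x * L y + L y * to_qmr x"

lemma lie_defect_eq_0: "lie_defect x y = 0"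
  using Lie[of x y] by (simp add: lie_defect_def commutator_def L_simps algebra_simps)

definition \<phi> :: "'a \<Rightarrow> 'a qmr" where
  "\<phi> y = L (t * y) - L t * to_qmr y - T * L y"

lemma additive_\<phi>: "additive \<phi>"
  by standard (simp add: \<phi>_def L_simps to_qmr_simps algebra_simps)

lemmas \<phi>_simps = additive.add[OF additive_\<phi>] additive.diff[OF additive_\<phi>]

definition E :: "'a \<Rightarrow> 'a \<Rightarrow> 'a qmr" where
  "E x y = to_qmr x * \<phi> (y * t) - T * to_qmr x * \<phi> y - \<phi> (t * y) * to_qmr x
    + \<phi> y * to_qmr x * T"

text \<open>Only \<open>\<phi>\<close>, a function of one variable, occurs in this functional identity. The combination of
  Lie defects in the proof was found by linear algebra.\<close>

lemma E_sym: "E x y - E y x = 0"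
proof -
  have "E x y - E y x = lie_defect x t * to_qmr (y * t) - lie_defect y t * to_qmr (x * t)
      + lie_defect (t * x) (t * y) - lie_defect (t * x) t * to_qmr y + lie_defect y (t * x * t)
      - lie_defect t (t * y) * to_qmr x - lie_defect x (t * y * t) - lie_defect (y * t) (x * t)"
    by (simp add: E_def \<phi>_def lie_defect_def algebra_simps to_qmr_mult)
  thus ?thesis by (simp add: lie_defect_eq_0)
qed

lemma \<phi>_commute: "\<phi> (y * t) - \<phi> (t * y) = \<phi> y * T - T * \<phi> y"
proof -
  have "\<phi> (y * t) - \<phi> (t * y) - (\<phi> y * T - T * \<phi> y) =
      lie_defect (t * y) t - T * lie_defect y t"
    by (simp add: \<phi>_def lie_defect_def algebra_simps to_qmr_mult)
  thus ?thesis by (simp add: lie_defect_eq_0)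
qed

text \<open>The defect of \<open>\<phi>\<close> against right multiplication by \<open>t\<close>; by
  \<open>\<phi>_commute\<close> it is also the defect against left multiplication.\<close>

definition \<psi> :: "'a \<Rightarrow> 'a qmr" where
  "\<psi> y = \<phi> (y * t) - \<phi> y * T"

lemma \<psi>_left: "\<psi> y = \<phi> (t * y) - T * \<phi> y"
  using \<phi>_commute[of y] by (simp add: \<psi>_def algebra_simps)

lemma additive_\<psi>: "additive \<psi>"
  by standard (simp add: \<psi>_def \<phi>_simps algebra_simps)

text \<open>Four instances of \<open>E_sym\<close>, at \<open>t * y * t\<close>,
  \<open>t * y\<close>, \<open>y * t\<close> and \<open>y\<close>, are combined so that all terms
  with \<open>x\<close> inside \<open>\<phi>\<close> cancel. The rest has degree one in
  \<open>x\<close>.\<close>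

lemma \<psi>_gpi: "T * T * to_qmr x * \<psi> y + T * to_qmr x * - (\<psi> (t * y) + \<psi> (y * t))
      + to_qmr x * \<psi> (t * y * t) =
    \<psi> y * to_qmr x * (T * T) + - (\<psi> (t * y) + \<psi> (y * t)) * to_qmr x * T
      + \<psi> (t * y * t) * to_qmr x"
proof -
  \<comment> \<open>Coefficients to the left of \<open>x\<close> arise in the form of
    \<open>\<psi>_left\<close>, those to the right in the form of the definition. Keeping both forms
    lets expansion suffice.\<close>
  define \<psi>' where "\<psi>' y = \<phi> (t * y) - T * \<phi> y" for y
  have "T * T * to_qmr x * \<psi> y + T * to_qmr x * - (\<psi> (t * y) + \<psi> (y * t))
      + to_qmr x * \<psi> (t * y * t) - (\<psi>' y * to_qmr x * (T * T)
      + - (\<psi>' (t * y) + \<psi>' (y * t)) * to_qmr x * T + \<psi>' (t * y * t) * to_qmr x) =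
      (E x (t * y * t) - E (t * y * t) x) - (E x (t * y) - E (t * y) x) * T
      - T * (E x (y * t) - E (y * t) x) + T * (E x y - E y x) * T"
    by (simp add: E_def \<psi>_def \<psi>'_def algebra_simps to_qmr_mult)
  thus ?thesis by (simp add: E_sym \<psi>'_def \<psi>_left)
qed

text \<open>In the decomposition \<open>L = d + h\<close> with \<open>d\<close> a derivation and \<open>h\<close> central one has
  \<open>\<phi> y = h (t y) - h t y - h y t\<close>, hence \<open>\<psi> y = h (t y t) - (h (t y) + h (y t)) t + h y t\<^sup>2\<close>.
  So \<open>h\<close> can be read off \<open>\<psi>\<close>.\<close>

definition h :: "'a \<Rightarrow> 'a qmr cent" where
  "h y = (THE c. \<exists>a b. \<psi> y = a \<cdot> 1 + b \<cdot> T + c \<cdot> (T * T))"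

lemma h_eqI:
  assumes "\<psi> y = a \<cdot> 1 + b \<cdot> T + c \<cdot> (T * T)"
  shows "h y = c"
  unfolding h_def
proof (rule the_equality)
  fix c'
  assume "\<exists>a b. \<psi> y = a \<cdot> 1 + b \<cdot> T + c' \<cdot> (T * T)"
  then obtain a' b' where "\<psi> y = a' \<cdot> 1 + b' \<cdot> T + c' \<cdot> (T * T)" by blast
  with assms have "(a - a') \<cdot> 1 + (b - b') \<cdot> T + (c - c') \<cdot> (T * T) = 0"
    by (simp add: algebra_simps)
  from independent_powers(3)[OF this] show "c' = c" by simp
qed (use assms in blast)

text \<open>By \<open>gpi_symmetric\<close> the lower coefficients of \<open>\<psi> y\<close> are
  the top coefficients of \<open>\<psi> (t * y * t)\<close> and
  \<open>- (\<psi> (t * y) + \<psi> (y * t))\<close>, that is, values of \<open>h\<close>.\<close>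

lemma \<psi>_eq: "\<psi> y = h (t * y * t) \<cdot> 1 - (h (t * y) + h (y * t)) \<cdot> T + h y \<cdot> (T * T)"
proof -
  obtain a b c d e f where *: "\<psi> y = a \<cdot> 1 + b \<cdot> T + c \<cdot> (T * T)"
    "- (\<psi> (t * y) + \<psi> (y * t)) = d \<cdot> 1 + e \<cdot> T + b \<cdot> (T * T)"
    "\<psi> (t * y * t) = f \<cdot> 1 + d \<cdot> T + a \<cdot> (T * T)"
    by (rule gpi_symmetric[OF \<psi>_gpi])
  \<comment> \<open>The instance at \<open>t * y\<close> shows that \<open>\<psi> (t * y)\<close>,
    and hence \<open>\<psi> (y * t)\<close>, is a polynomial in \<open>T\<close>.\<close>
  obtain a' b' c' d' e' f' where **: "\<psi> (t * y) = a' \<cdot> 1 + b' \<cdot> T + c' \<cdot> (T * T)"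
    "- (\<psi> (t * (t * y)) + \<psi> (t * y * t)) = d' \<cdot> 1 + e' \<cdot> T + b' \<cdot> (T * T)"
    "\<psi> (t * (t * y) * t) = f' \<cdot> 1 + d' \<cdot> T + a' \<cdot> (T * T)"
    by (rule gpi_symmetric[OF \<psi>_gpi])
  have "\<psi> (y * t) = (- a' - d) \<cdot> 1 + (- b' - e) \<cdot> T + (- c' - b) \<cdot> (T * T)"
    using **(1) *(2) by (simp add: algebra_simps eq_neg_iff_add_eq_0)
  with *(1,3) **(1) show ?thesis by (simp add: h_eqI)
qed

lemma additive_h: "additive h"
proof
  fix x y
  show "h (x + y) = h x + h y"
    by (rule h_eqI[where a = "h (t * x * t) + h (t * y * t)"
          and b = "- (h (t * x) + h (x * t)) - (h (t * y) + h (y * t))"])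
      (simp add: additive.add[OF additive_\<psi>] \<psi>_eq[of x] \<psi>_eq[of y] algebra_simps)
qed

lemmas h_simps = additive.add[OF additive_h] additive.diff[OF additive_h]
  additive.minus[OF additive_h] additive.zero[OF additive_h]

lemma \<psi>_commute: "\<psi> y * T = T * \<psi> y"
  by (simp add: \<psi>_eq algebra_simps)

text \<open>With \<open>\<gamma> x = \<psi> (x * t - t * x)\<close>, instances of
  \<open>E_sym\<close> give \<open>y * \<gamma> (x * t) = T * y * \<gamma> x\<close> for all
  \<open>y\<close>, and independence of \<open>1\<close> and \<open>T\<close> forces
  \<open>\<gamma> x = 0\<close>.\<close>

lemma \<psi>_commutator: "\<psi> (x * t - t * x) = 0"
proof -
  define g where "g x = \<phi> x * T - T * \<phi> x" for x
  define \<gamma> where "\<gamma> x = g (x * t) - g x * T" for x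
  have "to_qmr y * \<gamma> (x * t) - T * to_qmr y * \<gamma> x =
      (E (x * t) (y * t) - E (y * t) (x * t)) - (E (x * t) y - E y (x * t)) * T
      - (E x (y * t) - E (y * t) x) * T + (E x y - E y x) * T * T
      + to_qmr x * (\<psi> (y * t) * T - T * \<psi> (y * t)) - T * to_qmr x * (\<psi> y * T - T * \<psi> y)"
    for y
    by (simp add: E_def \<psi>_def \<gamma>_def g_def algebra_simps to_qmr_mult)
  hence "T * T * to_qmr y * 0 + T * to_qmr y * \<gamma> x + to_qmr y * - \<gamma> (x * t) = 0" for y
    by (simp add: E_sym \<psi>_commute)
  from gpi_left_coeffs(2)[OF this] have "\<gamma> x = 0" .
  moreover have \<phi>_t: "\<phi> (t * y) = \<phi> (y * t) - \<phi> y * T + T * \<phi> y" for y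
    using \<phi>_commute[of y] by (simp add: algebra_simps)
  have "\<gamma> x = \<psi> (x * t - t * x)"
    by (simp add: \<gamma>_def g_def \<psi>_def \<phi>_simps \<phi>_t[of x] \<phi>_t[of "x * t"] algebra_simps)
  ultimately show ?thesis by simp
qed

lemma h_commute: "h (x * t) = h (t * x)"
proof -
  let ?u = "x * t - t * x"
  have "h (t * ?u * t) \<cdot> 1 + (- (h (t * ?u) + h (?u * t))) \<cdot> T + h ?u \<cdot> (T * T) = 0"
    using \<psi>_eq[of ?u] \<psi>_commutator[of x] by (simp only: cent.scale_minus_left) simp
  from independent_powers(3)[OF this] show ?thesis by (simp add: h_simps)
qed

lemma h_commute': "h (t * (x * t)) = h (t * (t * x))"
  using h_commute[of "t * x"] by (simp add: mult.assoc)

section \<open>Vanishing of \<open>F\<close>, the derivation defect of \<open>L - h\<close> at the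
  pairs \<open>(t, y)\<close>\<close>

definition F :: "'a \<Rightarrow> 'a qmr" where
  "F y = \<phi> y - h (t * y) \<cdot> 1 + h t \<cdot> to_qmr y + h y \<cdot> T"

lemma additive_F: "additive F"
  by standard (simp add: F_def \<phi>_simps h_simps to_qmr_simps algebra_simps)

lemma F_right: "F (y * t) = F y * T"
proof -
  have "F (y * t) - F y * T = \<psi> y - h (t * y * t) \<cdot> 1 + h (t * y) \<cdot> T + h (y * t) \<cdot> T - h y \<cdot> (T * T)"
    by (simp add: F_def \<psi>_def to_qmr_mult algebra_simps)
  thus ?thesis by (simp add: \<psi>_eq algebra_simps)
qed

lemma F_left: "F (t * y) = T * F y"
proof -
  have "F (t * y) - T * F y = \<psi> y - h (t * y * t) \<cdot> 1 + h (t * y) \<cdot> T + h (y * t) \<cdot> T - h y \<cdot> (T * T)"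
    by (simp add: F_def \<psi>_left to_qmr_mult h_commute h_commute' algebra_simps del: mult.assoc)
  thus ?thesis by (simp add: \<psi>_eq algebra_simps)
qed

definition Z :: "'a \<Rightarrow> 'a \<Rightarrow> 'a qmr" where
  "Z x y = to_qmr x * F y + F y * to_qmr x - to_qmr y * F x - F x * to_qmr y"

text \<open>With \<open>F\<close> in place of \<open>\<phi>\<close>, the rules
  \<open>F_right\<close> and \<open>F_left\<close> turn \<open>E x y - E y x\<close> into the
  commutator of \<open>Z x y\<close> with \<open>T\<close>.\<close>

lemma Z_commute: "Z x y * T - T * Z x y = 0"
proof -
  have "Z x y * T - T * Z x y = to_qmr x * F (y * t) - T * to_qmr x * F y - F (t * y) * to_qmr x
      + F y * to_qmr x * T - (to_qmr y * F (x * t) - T * to_qmr y * F x - F (t * x) * to_qmr y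
      + F x * to_qmr y * T)"
    by (simp add: Z_def F_right F_left algebra_simps)
  also have "\<dots> = E x y - E y x"
    using h_commute[of x] h_commute[of y] h_commute'[of x] h_commute'[of y]
    by (simp add: E_def F_def to_qmr_mult algebra_simps)
  finally show ?thesis by (simp add: E_sym)
qed

lemma F_one: "F 1 = (h 1 - Abs_cent (L 1)) \<cdot> T"
proof -
  have "L 1 * to_qmr x = to_qmr x * L 1" for x
    using lie_defect_eq_0[of 1 x] by (simp add: lie_defect_def to_qmr_one)
  hence "L 1 \<in> center" by (rule centralizer_to_qmr)
  hence "Abs_cent (L 1) \<cdot> T = T * L 1" by (simp add: cscale_Abs centerD)
  thus ?thesis by (simp add: F_def \<phi>_def to_qmr_one algebra_simps)
qed

text \<open>\<open>Z_commute\<close> at \<open>y * t\<close> minus its instance at \<open>y\<close>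
  times \<open>T\<close>.\<close>

lemma F_commutator_right:
  fixes x y
  defines "u \<equiv> T * to_qmr x - to_qmr x * T"
  shows "(F y * u - to_qmr y * (T * F x - F x * T)) * T =
    T * (F y * u - to_qmr y * (T * F x - F x * T))"
proof -
  have "(F y * u - to_qmr y * (T * F x - F x * T)) * T
      - T * (F y * u - to_qmr y * (T * F x - F x * T)) =
      (Z x (y * t) * T - T * Z x (y * t)) - (Z x y * T - T * Z x y) * T"
    by (simp add: u_def Z_def F_right to_qmr_mult algebra_simps)
  thus ?thesis by (simp add: Z_commute)
qed

lemma F_commutator_left:
  fixes x y
  defines "u \<equiv> T * to_qmr x - to_qmr x * T"
  shows "(u * F y - (T * F x - F x * T) * to_qmr y) * T =
    T * (u * F y - (T * F x - F x * T) * to_qmr y)"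
proof -
  have "(u * F y - (T * F x - F x * T) * to_qmr y) * T
      - T * (u * F y - (T * F x - F x * T) * to_qmr y) =
      T * (Z x y * T - T * Z x y) - (Z x (t * y) * T - T * Z x (t * y))"
    by (simp add: u_def Z_def F_left to_qmr_mult algebra_simps)
  thus ?thesis by (simp add: Z_commute)
qed

text \<open>\<open>Z_commute\<close> with second argument \<open>1\<close> expresses the commutator
  of \<open>2 * F x\<close> with \<open>T\<close> through \<open>\<kappa>\<close>. The factor 2 is
  kept throughout, as the characteristic may be 2.\<close>

lemma F_one_eq_0: "F 1 = 0"
proof -
  define \<kappa> where "\<kappa> = h 1 - Abs_cent (L 1)"
  have F1: "F 1 = \<kappa> \<cdot> T" unfolding \<kappa>_def by (rule F_one)
  have F2: "2 * F x * T - T * (2 * F x) = \<kappa> \<cdot> (to_qmr x * (T * T) - T * (T * to_qmr x))" for x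
    using Z_commute[of x 1] by (simp add: Z_def F1 to_qmr_one algebra_simps mult_2)
  obtain \<alpha> where \<alpha>:
    "\<And>c0 c1 c2 c3. (\<And>x. c3 * to_qmr x * (T * (T * T)) + c2 * to_qmr x * (T * T) +
        c1 * to_qmr x * T + c0 * to_qmr x = 0) \<Longrightarrow> c2 + \<alpha> \<cdot> c3 = 0"
    "\<And>c0 c1 c2 c3. (\<And>x. T * (T * T) * to_qmr x * c3 + T * T * to_qmr x * c2 +
        T * to_qmr x * c1 + to_qmr x * c0 = 0) \<Longrightarrow> c2 + \<alpha> \<cdot> c3 = 0"
    by (rule gpi_cubic) blast
  \<comment> \<open>\<open>F_commutator_right\<close>, doubled and combined with \<open>F2\<close>,
    is cubic in \<open>T\<close>. Comparing coefficients expresses \<open>2 * F y\<close> through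
    \<open>\<kappa>\<close>; inserted into \<open>F2\<close>, this leaves a quadratic identity with
    leading coefficient \<open>\<kappa>\<close>.\<close>
  have F3: "- (2 * F y) - \<kappa> \<cdot> (T * to_qmr y) + \<alpha> \<cdot> (\<kappa> \<cdot> to_qmr y) = 0" for y
  proof (rule \<alpha>(1))
    fix x
    let ?u = "T * to_qmr x - to_qmr x * T"
    let ?w = "T * (2 * F x) - 2 * F x * T"
    have w: "?w = \<kappa> \<cdot> (T * (T * to_qmr x) - to_qmr x * (T * T))"
      using F2[of x] by (simp add: algebra_simps)
    let ?K = "F y * ?u - to_qmr y * (T * F x - F x * T)"
    have "(2 * F y * ?u - to_qmr y * ?w) * T - T * (2 * F y * ?u - to_qmr y * ?w) =
        2 * (?K * T - T * ?K)"
      by (simp add: mult_2 algebra_simps)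
    hence "(2 * F y * ?u - to_qmr y * ?w) * T - T * (2 * F y * ?u - to_qmr y * ?w) = 0"
      using F_commutator_right[of y x] by simp
    thus "\<kappa> \<cdot> to_qmr y * to_qmr x * (T * (T * T))
        + (- (2 * F y) - \<kappa> \<cdot> (T * to_qmr y)) * to_qmr x * (T * T)
        + (2 * F y * T + T * (2 * F y) - \<kappa> \<cdot> (to_qmr y * T * T)) * to_qmr x * T
        + (\<kappa> \<cdot> (T * to_qmr y * T * T) - T * (2 * F y) * T) * to_qmr x = 0"
      unfolding w by (simp add: algebra_simps)
  qed
  have "\<kappa> \<cdot> 1 * to_qmr x * (T * T) + (\<kappa> \<cdot> T - \<alpha> \<cdot> (\<kappa> \<cdot> 1)) * to_qmr x * T
      + (\<alpha> \<cdot> (\<kappa> \<cdot> T) - 2 * \<kappa> \<cdot> (T * T)) * to_qmr x = 0" for x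
  proof -
    have "2 * F x = \<alpha> \<cdot> (\<kappa> \<cdot> to_qmr x) - \<kappa> \<cdot> (T * to_qmr x)"
      using F3[of x] by (simp add: algebra_simps)
    from F2[of x, unfolded this] show ?thesis by (simp add: algebra_simps mult_2)
  qed
  from gpi_right_coeffs(1)[OF this] have "\<kappa> = 0" by (simp add: cscale_eq_0_iff)
  with F1 show ?thesis by simp
qed

text \<open>At \<open>t * x - x * t\<close> the value of \<open>F\<close> commutes with
  \<open>T\<close>, so the second term of \<open>F_commutator_right\<close> disappears there and
  \<open>F y\<close> is multiplied by a double commutator.\<close>

lemma F_eq_0: "F y = 0"
proof -
  define c where "c x = T * to_qmr x - to_qmr x * T" for x
  have F_c: "F (t * x - x * t) = T * F x - F x * T" for x
    by (simp add: additive.diff[OF additive_F] F_left F_right)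
  have to_qmr_c: "to_qmr (t * x - x * t) = c x" for x
    by (simp add: c_def to_qmr_simps)
  have F_cc: "T * F (t * x - x * t) - F (t * x - x * t) * T = 0" for x
    using F_commutator_right[of 1 x]
    by (simp add: F_one_eq_0 to_qmr_one F_c algebra_simps)
  obtain \<alpha> where \<alpha>:
    "\<And>c0 c1 c2 c3. (\<And>x. c3 * to_qmr x * (T * (T * T)) + c2 * to_qmr x * (T * T) +
        c1 * to_qmr x * T + c0 * to_qmr x = 0) \<Longrightarrow> c2 + \<alpha> \<cdot> c3 = 0"
    "\<And>c0 c1 c2 c3. (\<And>x. T * (T * T) * to_qmr x * c3 + T * T * to_qmr x * c2 +
        T * to_qmr x * c1 + to_qmr x * c0 = 0) \<Longrightarrow> c2 + \<alpha> \<cdot> c3 = 0"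
    by (rule gpi_cubic) blast
  have right: "- (2 * F y * T) - T * F y + \<alpha> \<cdot> F y = 0" for y
  proof (rule \<alpha>(1))
    fix x
    have "F y * (T * c x - c x * T) * T = T * (F y * (T * c x - c x * T))"
      using F_commutator_right[of y "t * x - x * t"] F_cc[of x] by (simp add: to_qmr_c)
    thus "F y * to_qmr x * (T * (T * T)) + (- (2 * F y * T) - T * F y) * to_qmr x * (T * T)
        + (F y * T * T + 2 * T * F y * T) * to_qmr x * T + (- (T * F y * T * T)) * to_qmr x = 0"
      by (simp add: c_def mult_2 algebra_simps)
  qed
  have left: "2 * T * F y + F y * T + \<alpha> \<cdot> (- F y) = 0" for y
  proof (rule \<alpha>(2))
    fix x
    have "(T * c x - c x * T) * F y * T = T * ((T * c x - c x * T) * F y)"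
      using F_commutator_left[of "t * x - x * t" y] F_cc[of x] by (simp add: to_qmr_c)
    thus "T * (T * T) * to_qmr x * - F y + T * T * to_qmr x * (2 * T * F y + F y * T)
        + T * to_qmr x * (- (T * T * F y) - 2 * T * F y * T) + to_qmr x * (T * T * F y * T) = 0"
      by (simp add: c_def mult_2 algebra_simps)
  qed
  \<comment> \<open>Both identities have the same \<open>\<alpha>\<close>, which cancels in their
    sum.\<close>
  have comm: "T * F y = F y * T" for y
    using right[of y] left[of y] by (simp add: mult_2 algebra_simps)
  have "- F y * to_qmr x * (T * T) + (F y * T + T * F y) * to_qmr x * T
      + - (T * F y * T) * to_qmr x = 0" for x
    using F_commutator_right[of y x] by (simp add: comm[of x] algebra_simps)
  from gpi_right_coeffs(1)[OF this] show ?thesis by simp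
qed

section \<open>Vanishing of \<open>N\<close>, the derivation defect of \<open>L - h\<close>, at all
  pairs\<close>

definition N :: "'a \<Rightarrow> 'a \<Rightarrow> 'a qmr" where
  "N x y = (L (x * y) - h (x * y) \<cdot> 1) - (L x - h x \<cdot> 1) * to_qmr y - to_qmr x * (L y - h y \<cdot> 1)"

text \<open>Up to sign, \<open>N\<close> is the Hochschild coboundary of
  \<open>L - h\<close>.\<close>

lemma N_cocycle: "to_qmr x * N y z - N (x * y) z + N x (y * z) - N x y * to_qmr z = 0"
  by (simp add: N_def to_qmr_mult algebra_simps)

lemma N_t_left: "N t y = 0"
  using F_eq_0[of y] by (simp add: N_def F_def \<phi>_def algebra_simps)

lemma N_symmetric: "N x y = N y x + (h (y * x) - h (x * y)) \<cdot> 1"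
  using lie_defect_eq_0[of x y] by (simp add: N_def lie_defect_def algebra_simps)

lemma N_t_right: "N y t = 0"
  using N_symmetric[of y t] by (simp add: N_t_left h_commute)

text \<open>Here and in the next two lemmas, one argument of the cocycle identity is
  \<open>t\<close> and two of its terms vanish.\<close>

lemma N_mult_left: "N (t * x) y = T * N x y"
  using N_cocycle[of t x y] by (simp add: N_t_left)

lemma N_mult_right: "N x (y * t) = N x y * T"
  using N_cocycle[of x y t] by (simp add: N_t_right)

lemma N_middle: "N (x * t) y = N x (t * y)"
  using N_cocycle[of x t y] by (simp add: N_t_left N_t_right)

text \<open>By \<open>N_symmetric\<close> the commutator is a scalar \<open>e x y\<close>. Replacing
  \<open>x\<close> by \<open>t * x\<close> multiplies it by \<open>T\<close>, so
  \<open>T * e x y\<close> is a scalar too, and \<open>e x y = 0\<close>.\<close>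

lemma N_commute: "T * N x y = N x y * T"
proof -
  define e where "e x y = h (x * y * t) - h (t * x * y)" for x y
  have e: "T * N x y - N x y * T = e x y \<cdot> 1" for x y
    using N_symmetric[of "t * x" y] N_symmetric[of x "y * t"] N_middle[of y x]
    by (simp add: N_mult_left N_mult_right e_def mult.assoc algebra_simps)
  have "- e (t * x) y \<cdot> 1 + e x y \<cdot> T + 0 \<cdot> (T * T) = T * e x y \<cdot> 1 - e (t * x) y \<cdot> 1"
    by (simp add: algebra_simps)
  also have "\<dots> = 0"
    unfolding e[symmetric] by (simp add: N_mult_left algebra_simps)
  finally have "e x y = 0" by (rule independent_powers)
  with e[of x y] show ?thesis by simp
qed

text \<open>This is \<open>L\<close> applied to
  \<open>[x y, z] + [y z, x] + [z x, y] = 0\<close>.\<close>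

lemma N_cyclic: "N y x * to_qmr z - to_qmr z * N y x + (N y z * to_qmr x - to_qmr x * N y z)
    + (N z x * to_qmr y - to_qmr y * N z x) = 0"
proof -
  have "N y x * to_qmr z - to_qmr z * N y x = N x y * to_qmr z - to_qmr z * N x y"
    by (simp add: N_symmetric[of y x] algebra_simps)
  moreover have "N x y * to_qmr z - to_qmr z * N x y + (N y z * to_qmr x - to_qmr x * N y z)
      + (N z x * to_qmr y - to_qmr y * N z x) =
      - (lie_defect (x * y) z + lie_defect (y * z) x + lie_defect (z * x) y)"
    by (simp add: N_def lie_defect_def to_qmr_mult algebra_simps)
  ultimately show ?thesis by (simp add: lie_defect_eq_0)
qed

text \<open>\<open>N_cyclic\<close> at \<open>t * y\<close> minus \<open>T\<close> times
  \<open>N_cyclic\<close> at \<open>y\<close>.\<close>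

lemma N_exchange: "(T * to_qmr z - to_qmr z * T) * N y x + (T * to_qmr x - to_qmr x * T) * N y z = 0"
proof -
  have "(T * to_qmr z - to_qmr z * T) * N y x + (T * to_qmr x - to_qmr x * T) * N y z =
    (N (t * y) x * to_qmr z - to_qmr z * N (t * y) x
      + (N (t * y) z * to_qmr x - to_qmr x * N (t * y) z)
      + (N z x * to_qmr (t * y) - to_qmr (t * y) * N z x))
    - T * (N y x * to_qmr z - to_qmr z * N y x + (N y z * to_qmr x - to_qmr x * N y z)
      + (N z x * to_qmr y - to_qmr y * N z x))
    + (T * N z x - N z x * T) * to_qmr y"
    by (simp add: N_mult_left to_qmr_mult algebra_simps)
  thus ?thesis by (simp only: N_cyclic N_commute) simp
qed

text \<open>\<open>N_exchange\<close> at \<open>t * x\<close> minus \<open>T\<close> times its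
  instance at \<open>x\<close> removes \<open>N y z\<close> and leaves an identity in
  \<open>z\<close> with leading coefficient \<open>- N y x\<close>.\<close>

lemma N_eq_0: "N y x = 0"
proof -
  have "T * T * to_qmr z * - N y x + T * to_qmr z * (T * N y x + N y (t * x))
      + to_qmr z * - (T * N y (t * x)) = 0" for z
  proof -
    have "T * T * to_qmr z * - N y x + T * to_qmr z * (T * N y x + N y (t * x))
        + to_qmr z * - (T * N y (t * x)) =
      ((T * to_qmr z - to_qmr z * T) * N y (t * x)
        + (T * to_qmr (t * x) - to_qmr (t * x) * T) * N y z)
      - T * ((T * to_qmr z - to_qmr z * T) * N y x + (T * to_qmr x - to_qmr x * T) * N y z)"
      by (simp add: to_qmr_mult algebra_simps)
    thus ?thesis by (simp only: N_exchange) simp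
  qed
  from gpi_left_coeffs(1)[OF this] show ?thesis by simp
qed

lemma derivation_plus_central:
  shows "L (x * y) - h (x * y) \<cdot> 1 = (L x - h x \<cdot> 1) * to_qmr y + to_qmr x * (L y - h y \<cdot> 1)"
    and "h (commutator x y) = 0"
proof -
  show "L (x * y) - h (x * y) \<cdot> 1 = (L x - h x \<cdot> 1) * to_qmr y + to_qmr x * (L y - h y \<cdot> 1)"
    using N_eq_0[of x y] by (simp add: N_def algebra_simps)
  have "(h (y * x) - h (x * y)) \<cdot> (1 :: 'a qmr) = 0"
    using N_symmetric[of x y] by (simp add: N_eq_0)
  thus "h (commutator x y) = 0"
    by (simp add: cscale_eq_0_iff commutator_def h_simps)
qed

end

section \<open>Degree over the center and over the extended centroid\<close>

lemma to_qmr_in_center_iff: "to_qmr z \<in> center \<longleftrightarrow> z \<in> center"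
proof
  assume "to_qmr z \<in> center"
  hence "to_qmr (z * x) = to_qmr (x * z)" for x by (simp add: to_qmr_mult centerD)
  thus "z \<in> center" by (auto intro!: centerI simp: to_qmr_eq_iff)
next
  assume z: "z \<in> center"
  show "to_qmr z \<in> center"
    by (rule centralizer_to_qmr) (simp flip: to_qmr_mult add: centerD[OF z])
qed

lemma cscale_in_center: "z \<in> center \<Longrightarrow> c \<cdot> z \<in> center"
  unfolding cscale_def by (intro center_closed Rep_cent)

lemma deg_elt_le:
  assumes "n \<le> m" "\<And>i. i \<le> n \<Longrightarrow> z i \<in> center" "z n \<noteq> 0" "(\<Sum>i\<le>n. z i * a ^ i) = 0"
  shows "deg_elt a \<le> enat m"
  unfolding deg_elt_def by (rule INF_lower2[of n]) (use assms in auto)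

context prime_ring
begin

text \<open>The multiplier \<open>z\<close> is the square of a commutator \<open>[a, b]\<close> unless \<open>\<alpha> = 0\<close>. Otherwise all these
  squares vanish, and linearizing \<open>[a, b]\<^sup>2 = 0\<close> makes \<open>a\<close> central.\<close>

lemma quadratic_over_center:
  fixes a :: 'a
  assumes quadratic: "\<And>x :: 'a. to_qmr x * to_qmr x \<in> cent.span {1, to_qmr x}"
    and a: "a \<notin> center" and \<alpha>\<beta>: "to_qmr a * to_qmr a = \<alpha> \<cdot> to_qmr a + \<beta> \<cdot> 1"
  shows "\<exists>z u. z \<noteq> 0 \<and> z \<in> center \<and> \<alpha> \<cdot> to_qmr z = to_qmr u"
proof (rule ccontr)
  assume contr: "\<not> ?thesis"
  define A where "A = to_qmr a"
  note AA = \<alpha>\<beta>[folded A_def]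
  define w where "w b = A * to_qmr b - to_qmr b * A" for b
  have w: "w b = to_qmr (a * b - b * a)" for b
    by (simp add: w_def A_def to_qmr_simps)
  have quad: "\<exists>\<sigma> \<mu>. to_qmr x * to_qmr x = \<sigma> \<cdot> to_qmr x + \<mu> \<cdot> 1" for x :: 'a
  proof -
    obtain \<mu> \<sigma> where "to_qmr x * to_qmr x - \<mu> \<cdot> 1 = \<sigma> \<cdot> to_qmr x"
      using quadratic[of x] by (auto simp: cent.span_insert)
    hence "to_qmr x * to_qmr x = \<sigma> \<cdot> to_qmr x + \<mu> \<cdot> 1" by (simp add: algebra_simps)
    thus ?thesis by blast
  qed
  have two: "2 \<cdot> q = q + q" for q :: "'a qmr"
    by (metis cent.scale_left_distrib cent.scale_one one_add_one)
  \<comment> \<open>By the quadratic equation of \<open>A\<close>, \<open>\<alpha>\<close> times a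
    commutator with \<open>a\<close> lies in the ring; this supplies \<open>u\<close>.\<close>
  have \<alpha>w: "\<alpha> \<cdot> w b = A * w b + w b * A" for b
  proof -
    have "A * w b + w b * A = A * A * to_qmr b - to_qmr b * (A * A)"
      by (simp add: w_def algebra_simps)
    thus ?thesis unfolding AA by (simp add: w_def algebra_simps)
  qed
  have \<alpha>: "\<alpha> \<noteq> 0"
  proof
    assume "\<alpha> = 0"
    hence "(1 :: 'a) \<noteq> 0 \<and> (1 :: 'a) \<in> center \<and> \<alpha> \<cdot> to_qmr 1 = to_qmr (0 :: 'a)"
      by (auto intro: centerI simp: to_qmr_zero)
    with contr show False by blast
  qed
  have central_square: "w b * w b = 0" if "w b * w b = \<mu> \<cdot> 1" for b \<mu>
  proof (rule ccontr)
    let ?v = "a * b - b * a"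
    assume "w b * w b \<noteq> 0"
    hence "?v * ?v \<noteq> 0" by (auto simp: w to_qmr_zero simp flip: to_qmr_mult)
    moreover have "to_qmr (?v * ?v) \<in> center"
      using that by (simp add: w to_qmr_mult) (simp add: cscale_in_center centerI)
    moreover have "\<alpha> \<cdot> to_qmr (?v * ?v) = to_qmr ((a * ?v + ?v * a) * ?v)"
    proof -
      have "\<alpha> \<cdot> to_qmr (?v * ?v) = \<alpha> \<cdot> w b * w b" by (simp add: w to_qmr_mult)
      also have "\<dots> = (A * w b + w b * A) * w b" by (simp only: \<alpha>w)
      also have "\<dots> = to_qmr ((a * ?v + ?v * a) * ?v)"
        unfolding w A_def by (simp only: to_qmr_mult to_qmr_add)
      finally show ?thesis .
    qed
    ultimately show False using contr unfolding to_qmr_in_center_iff by blast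
  qed
  have square: "w b * w b = 0" for b
  proof -
    obtain \<sigma> \<mu> where \<sigma>\<mu>: "w b * w b = \<sigma> \<cdot> w b + \<mu> \<cdot> 1"
      using quad[of "a * b - b * a"] unfolding w by blast
    \<comment> \<open>\<open>w b * w b\<close> commutes with \<open>A\<close>, so either
      \<open>\<sigma> = 0\<close> or \<open>w b\<close> itself commutes with
      \<open>A\<close>.\<close>
    have "w b * w b * A - A * (w b * w b) =
        w b * (A * w b + w b * A) - (A * w b + w b * A) * w b"
      by (simp add: algebra_simps)
    also have "\<dots> = 0" unfolding \<alpha>w[symmetric] by simp
    finally have "\<sigma> \<cdot> (w b * A - A * w b) = 0"
      unfolding \<sigma>\<mu> by (simp add: algebra_simps)
    then consider "\<sigma> = 0" | "w b * A = A * w b" by (auto simp: cscale_eq_0_iff)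
    thus ?thesis
    proof cases
      case 1
      with \<sigma>\<mu> central_square show ?thesis by simp
    next
      case 2
      \<comment> \<open>\<open>n = 2 A - \<alpha>\<close> annihilates \<open>w b\<close>, has scalar
        square and satisfies \<open>[n, b] = 2 w b\<close>. If \<open>n n = 0\<close>, then
        \<open>n b n = 0\<close>, and the quadratic equation of \<open>b\<close> gives
        \<open>4 (w b)^2 = 0\<close>; characteristic 2 is treated separately.\<close>
      define n where "n = A + A - \<alpha> \<cdot> 1"
      have nw: "n * w b = 0" and wn: "w b * n = 0"
        using \<alpha>w[of b] 2 by (simp_all add: n_def algebra_simps)
      have "n * n = \<beta> \<cdot> 1 + \<beta> \<cdot> 1 + \<beta> \<cdot> 1 + \<beta> \<cdot> 1 + (\<alpha> * \<alpha>) \<cdot> 1"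
        using AA by (simp add: n_def algebra_simps)
      hence nn: "n * n = (\<beta> + \<beta> + \<beta> + \<beta> + \<alpha> * \<alpha>) \<cdot> 1"
        by (simp only: cent.scale_left_distrib)
      have two_w: "w b + w b = n * to_qmr b - to_qmr b * n"
        by (simp add: n_def w_def algebra_simps)
      have "(\<beta> + \<beta> + \<beta> + \<beta> + \<alpha> * \<alpha>) \<cdot> w b = n * (n * w b)"
        by (simp add: nn flip: mult.assoc)
      hence "\<beta> + \<beta> + \<beta> + \<beta> + \<alpha> * \<alpha> = 0 \<or> w b = 0" by (simp add: nw cscale_eq_0_iff)
      thus ?thesis
      proof
        assume "\<beta> + \<beta> + \<beta> + \<beta> + \<alpha> * \<alpha> = 0"
        hence nn0: "n * n = 0" by (simp add: nn)
        have "n * to_qmr b * n = n * n * to_qmr b - n * (w b + w b)"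
          by (simp add: two_w algebra_simps)
        hence nbn: "n * to_qmr b * n = 0" by (simp add: nn0 nw distrib_left)
        obtain \<sigma>' \<mu>' where b: "to_qmr b * to_qmr b = \<sigma>' \<cdot> to_qmr b + \<mu>' \<cdot> 1"
          using quad by blast
        have "n * (to_qmr b * to_qmr b) * n = \<sigma>' \<cdot> (n * to_qmr b * n) + \<mu>' \<cdot> (n * n)"
          unfolding b by (simp add: algebra_simps)
        hence nbbn: "n * (to_qmr b * to_qmr b) * n = 0" by (simp add: nbn nn0)
        have "(w b + w b) * (w b + w b) = n * to_qmr b * n * to_qmr b
            - n * (to_qmr b * to_qmr b) * n - to_qmr b * (n * n) * to_qmr b
            + to_qmr b * (n * to_qmr b * n)"
          by (simp add: two_w algebra_simps)
        hence "(w b + w b) * (w b + w b) = 0" by (simp only: nbn nbbn nn0) simp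
        moreover have "(w b + w b) * (w b + w b) = 2 \<cdot> 2 \<cdot> (w b * w b)"
          by (simp only: two distrib_left distrib_right)
        ultimately have "(2 :: 'a qmr cent) = 0 \<or> w b * w b = 0" 
          by (simp add: cscale_eq_0_iff del: cent.scale_scale)
        moreover have "w b = 0" if "(2 :: 'a qmr cent) = 0"
        proof -
          have "\<alpha> \<cdot> w b = 2 \<cdot> (A * w b)"
            using \<alpha>w[of b] by (simp only: two 2)
          with that \<alpha> show ?thesis by (simp add: cscale_eq_0_iff)
        qed
        ultimately show ?thesis by auto
      qed simp
    qed
  qed
  have A: "A \<notin> cent.span {1}"
  proof
    assume "A \<in> cent.span {1}"
    then obtain c where "A = c \<cdot> 1" by (auto simp: cent.span_insert)
    hence "to_qmr a \<in> center" by (simp add: A_def cscale_in_center centerI)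
    with a show False by (simp add: to_qmr_in_center_iff)
  qed
  \<comment> \<open>Linearizing \<open>square\<close> gives an identity in \<open>b\<close>. An
    operator killing \<open>1\<close> and \<open>A\<close> but not \<open>w c\<close>, applied to
    the left factors, would contradict the independence of \<open>1\<close> and
    \<open>A\<close>.\<close>
  have w_span: "w c \<in> cent.span {1, A}" for c
  proof (rule ccontr)
    assume "w c \<notin> cent.span {1, A}"
    then obtain ps where ps: "mult_op ps (w c) \<noteq> 0" "mult_op ps 1 = 0" "mult_op ps A = 0"
      using separating_mult_op[of "{1, A}" "w c"] by auto
    have neg: "mult_op ps (- q) = - mult_op ps q" for q
      using mult_op_diff[of ps 0 q] mult_op_diff[of ps 0 0] by simp
    have "(\<Sum>(p, q)\<leftarrow>[(A, w c), (- 1, A * w c), (w c * A, 1), (- w c, A)]. p * to_qmr b * q) = 0"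
      for b
    proof -
      have "w (b + c) = w b + w c" by (simp add: w_def to_qmr_add algebra_simps)
      hence "w b * w c + w c * w b = 0"
        using square[of "b + c"] square[of b] square[of c] by (simp add: algebra_simps)
      thus ?thesis by (simp add: w_def[of b] algebra_simps)
    qed
    from gpi_mult_op_left[OF this, where ps = ps]
    have "- mult_op ps (w c) * to_qmr b * A + mult_op ps (w c * A) * to_qmr b = 0" for b
      using ps(2,3) by (simp add: neg algebra_simps)
    with gpi_right_coeff[of "- mult_op ps (w c)" A "[(mult_op ps (w c * A), 1)]"] A ps(1)
    show False by simp
  qed
  have w_commute: "A * w c = w c * A" for c
  proof -
    obtain \<mu> \<sigma> where "w c - \<mu> \<cdot> 1 = \<sigma> \<cdot> A"
      using w_span[of c] by (auto simp: cent.span_insert)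
    hence "w c = \<sigma> \<cdot> A + \<mu> \<cdot> 1" by (simp add: algebra_simps)
    thus ?thesis by (simp add: algebra_simps)
  qed
  \<comment> \<open>This is \<open>[A, [A, x]] = 0\<close>, reduced by \<open>AA\<close>. Both
    coefficients vanish, so \<open>\<alpha> \<cdot> A\<close> and hence \<open>a\<close> would be
    central.\<close>
  have gpi: "A * to_qmr x * (\<alpha> \<cdot> 1 - A - A) + 1 * to_qmr x * (\<beta> \<cdot> 1 + \<beta> \<cdot> 1 + \<alpha> \<cdot> A) = 0" for x
  proof -
    have "A * A * to_qmr x - A * to_qmr x * A - A * to_qmr x * A + to_qmr x * (A * A) = 0"
      using w_commute[of x] by (simp add: w_def algebra_simps)
    thus ?thesis unfolding AA by (simp add: algebra_simps)
  qed
  hence 0: "\<alpha> \<cdot> 1 - A - A = 0"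
    using gpi_left_coeff[of A "\<alpha> \<cdot> 1 - A - A" "[(1, \<beta> \<cdot> 1 + \<beta> \<cdot> 1 + \<alpha> \<cdot> A)]"] A by simp
  have "\<beta> \<cdot> 1 + \<beta> \<cdot> 1 + \<alpha> \<cdot> A = 0"
    using gpi[of 1] unfolding 0 by (simp add: to_qmr_one)
  hence \<alpha>A: "\<alpha> \<cdot> A = - (\<beta> \<cdot> 1) - \<beta> \<cdot> 1"
    by (simp only: minus_add_distrib[symmetric] diff_conv_add_uminus eq_neg_iff_add_eq_0 ac_simps)
  have "\<alpha> \<cdot> (A * q - q * A) = 0" for q
  proof -
    have "\<alpha> \<cdot> (A * q - q * A) = \<alpha> \<cdot> A * q - q * \<alpha> \<cdot> A"
      by (simp add: cent.scale_right_diff_distrib)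
    also have "\<dots> = 0" unfolding \<alpha>A by (simp add: algebra_simps)
    finally show ?thesis .
  qed
  with \<alpha> have "A * q = q * A" for q by (simp add: cscale_eq_0_iff)
  hence "to_qmr a \<in> center" by (auto simp: A_def intro: centerI)
  with a show False by (simp add: to_qmr_in_center_iff)
qed

text \<open>Otherwise every element is quadratic over the extended centroid. For noncentral
  \<open>a\<close>, the multiplier \<open>z\<close> of \<open>quadratic_over_center\<close> moves
  the coefficients into the center of the ring: \<open>z (a a) = u a + v\<close>.\<close>

lemma ex_nonquadratic:
  assumes "deg_alg TYPE('a) \<ge> 3"
  shows "\<exists>t :: 'a. to_qmr t * to_qmr t \<notin> cent.span {1, to_qmr t}"
proof (rule ccontr)
  assume "\<not> ?thesis"
  hence quadratic: "\<And>x :: 'a. to_qmr x * to_qmr x \<in> cent.span {1, to_qmr x}" by blast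
  have "deg_elt a \<le> enat 2" for a :: 'a
  proof (cases "a \<in> center")
    case True
    show ?thesis
      by (rule deg_elt_le[of 1 2 "\<lambda>i. if i = 0 then - a else 1"])
        (use True in \<open>auto intro: center_closed centerI simp: atMost_Suc\<close>)
  next
    case False
    obtain \<beta> \<alpha> where "to_qmr a * to_qmr a - \<beta> \<cdot> 1 = \<alpha> \<cdot> to_qmr a"
      using quadratic[of a] by (auto simp: cent.span_insert)
    hence aa: "to_qmr a * to_qmr a = \<alpha> \<cdot> to_qmr a + \<beta> \<cdot> 1" by (simp add: algebra_simps)
    obtain z u where z: "z \<noteq> 0" "z \<in> center" and u: "\<alpha> \<cdot> to_qmr z = to_qmr u"
      using quadratic_over_center[OF quadratic False aa] by blast
    have zQ: "to_qmr z \<in> center" using z(2) by (simp add: to_qmr_in_center_iff)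
    define v where "v = z * (a * a) - u * a"
    have "to_qmr v = to_qmr z * (to_qmr a * to_qmr a) - \<alpha> \<cdot> to_qmr z * to_qmr a"
      by (simp only: u v_def to_qmr_diff to_qmr_mult)
    also have "\<dots> = \<beta> \<cdot> to_qmr z" unfolding aa by (simp add: algebra_simps)
    finally have "v \<in> center" "u \<in> center"
      using cscale_in_center[OF zQ, of \<beta>] cscale_in_center[OF zQ, of \<alpha>] u
        to_qmr_in_center_iff[of v] to_qmr_in_center_iff[of u] by simp_all
    hence "(if i = 0 then - v else if i = 1 then - u else z) \<in> center" for i :: nat
      using z(2) by (simp add: center_closed)
    thus ?thesis
      by (rule deg_elt_le[of 2 2 "\<lambda>i. if i = 0 then - v else if i = 1 then - u else z", rotated])
        (simp_all add: z(1) v_def numeral_2_eq_2 atMost_Suc algebra_simps)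
  qed
  hence "deg_alg TYPE('a) \<le> enat 2" by (auto simp: deg_alg_def intro: SUP_least)
  from order_trans[OF assms this] show False by (simp add: numeral_eq_enat)
qed

end

section \<open>Jordan derivations\<close>

text \<open>For \<open>x\<close> outside \<open>P\<close> and \<open>y\<close> outside
  \<open>Q\<close>, the element \<open>x - y\<close> can lie in neither.\<close>

lemma additive_subgroups_cover:
  fixes P Q :: "'a::ab_group_add \<Rightarrow> bool"
  assumes P: "\<And>x y. P x \<Longrightarrow> P y \<Longrightarrow> P (x - y)" and Q: "\<And>x y. Q x \<Longrightarrow> Q y \<Longrightarrow> Q (x - y)"
    and cover: "\<And>x. P x \<or> Q x"
  shows "(\<forall>x. P x) \<or> (\<forall>x. Q x)"
proof (rule ccontr)
  assume "\<not> ?thesis"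
  then obtain x y where x: "\<not> P x" and y: "\<not> Q y" by blast
  with cover have Qx: "Q x" and Py: "P y" by blast+
  from cover[of "x - y"] show False
  proof
    assume "P (x - y)"
    from P[OF this, of "- y"] P[OF P[OF Py Py] Py] x show False by simp
  next
    assume "Q (x - y)"
    from Q[OF Qx this] y show False by simp
  qed
qed

context prime_ring
begin

text \<open>Three uses of the skew identity carry \<open>p x q y p x q\<close> to its negative; then
  primeness is used twice.\<close>

lemma skew_pair:
  fixes p q :: 'a
  assumes two: "\<And>x :: 'a. x + x = 0 \<Longrightarrow> x = 0"
    and skew: "\<And>x. p * x * q + q * x * p = 0"
  shows "p = 0 \<or> q = 0"
proof -
  have "p * x * q = 0" for x
  proof -
    have "(p * x * q) * y * (p * x * q) = 0" for y
    proof (rule two)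
      have "p * x * q * y * (p * x * q) + p * x * q * y * (p * x * q) =
          (p * x * q + q * x * p) * y * p * x * q
          - (p * (x * p * y) * q + q * (x * p * y) * p) * x * q
          + p * x * (p * y * q + q * y * p) * x * q"
        by (simp add: algebra_simps)
      thus "p * x * q * y * (p * x * q) + p * x * q * y * (p * x * q) = 0" by (simp add: skew)
    qed
    with prime show ?thesis by blast
  qed
  with prime show ?thesis by blast
qed

lemma jordan_derivation:
  fixes d :: "'a \<Rightarrow> 'a"
  assumes two: "\<And>x :: 'a. x + x = 0 \<Longrightarrow> x = 0" and "additive d"
    and jordan: "\<And>x y. d (x * y + y * x) = d x * y + x * d y + d y * x + y * d x"
  shows "d (x * y) = d x * y + x * d y"
proof -
  note d_add = additive.add[OF \<open>additive d\<close>]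
  have sq: "d (x * x) = d x * x + x * d x" for x
  proof -
    let ?e = "d (x * x) - d x * x - x * d x"
    have "?e + ?e = 0" using jordan[of x x] by (simp add: d_add algebra_simps)
    with two have "?e = 0" by blast
    thus ?thesis by (simp add: algebra_simps)
  qed
  have triple: "d (x * y * x) = d x * y * x + x * d y * x + x * y * d x" for x y
  proof -
    let ?e = "d (x * y * x) - d x * y * x - x * d y * x - x * y * d x"
    \<comment> \<open>The Jordan product of \<open>x\<close> with \<open>x * y + y * x\<close> is
      computed in two ways.\<close>
    have "d (x * (x * y + y * x) + (x * y + y * x) * x) = d (x * x * y + y * (x * x)) +
        (d (x * y * x) + d (x * y * x))"
      by (simp add: d_add algebra_simps)
    hence "?e + ?e = 0"
      unfolding jordan sq by (simp add: algebra_simps)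
    with two have "?e = 0" by blast
    thus ?thesis by (simp add: algebra_simps)
  qed
  have triple2: "d (x * y * z + z * y * x) = d x * y * z + x * d y * z + x * y * d z
      + d z * y * x + z * d y * x + z * y * d x" for x y z
    using triple[of "x + z" y] triple[of x y] triple[of z y] by (simp add: d_add algebra_simps)
  define F where "F x y = d (x * y) - d x * y - x * d y" for x y
  have F_skew: "F y x = - F x y" for x y
    using jordan[of x y] by (simp add: F_def d_add algebra_simps eq_neg_iff_add_eq_0)
  have cover: "F x y = 0 \<or> x * y - y * x = 0" for x y
  proof (rule skew_pair[OF two])
    fix z
    \<comment> \<open>The left side is evaluated by \<open>triple2\<close>, the right side by
      \<open>triple\<close> twice.\<close>
    have "d ((x * y) * z * (y * x) + (y * x) * z * (x * y)) =
        d (x * (y * z * y) * x) + d (y * (x * z * x) * y)"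
      by (simp add: d_add mult.assoc)
    hence "F x y * z * (y * x) + x * y * z * F y x + F y x * z * (x * y) + y * x * z * F x y = 0"
      unfolding triple2 triple by (simp add: F_def algebra_simps)
    thus "F x y * z * (x * y - y * x) + (x * y - y * x) * z * F x y = 0"
      by (simp add: F_skew[of x y] algebra_simps)
  qed
  have F_diff: "F (x - x') y = F x y - F x' y" "F x (y - y') = F x y - F x y'" for x x' y y'
    by (simp_all add: F_def additive.diff[OF \<open>additive d\<close>] algebra_simps)
  \<comment> \<open>Each alternative in \<open>cover\<close> is additive in \<open>y\<close>, then
    in \<open>x\<close>, so one of them holds globally.\<close>
  have *: "(\<forall>y. F x y = 0) \<or> (\<forall>y. x * y - y * x = 0)" for x
    by (rule additive_subgroups_cover[of "\<lambda>y. F x y = 0" "\<lambda>y. x * y - y * x = 0"])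
      (use cover in \<open>simp_all add: F_diff algebra_simps\<close>)
  have "(\<forall>x. \<forall>y. F x y = 0) \<or> (\<forall>x::'a. \<forall>y. x * y - y * x = 0)"
    by (rule additive_subgroups_cover[of "\<lambda>x. \<forall>y. F x y = 0" "\<lambda>x. \<forall>y. x * y - y * x = 0"])
      (use * in \<open>simp_all add: F_diff algebra_simps\<close>)
  hence "F x y = 0"
  proof
    assume "\<forall>x::'a. \<forall>y. x * y - y * x = 0"
    hence comm: "\<And>x y :: 'a. x * y = y * x" by simp
    have "F y x = F x y" unfolding F_def by (simp add: comm[of y] comm[of "d y"])
    with F_skew[of x y] two[of "F x y"] show ?thesis by (simp add: eq_neg_iff_add_eq_0)
  qed simp
  thus ?thesis by (simp add: F_def algebra_simps)
qed

end

section \<open>Generalized Lie derivations\<close>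

text \<open>The brackets of \<open>a\<close> with \<open>1\<close> in both orders agree, so
  \<open>D = \<delta> - L\<close> satisfies \<open>(1 + \<xi>) (D a - D 1 * a) = 0\<close>. For
  \<open>\<xi> = - 1\<close> additivity at \<open>a + a\<close> is used instead.\<close>

lemma (in unital_algebra) relating_difference:
  assumes "additive \<delta>" and rel: "relating_xi_Lie_derivation scale \<xi> \<delta> L"
  shows "\<delta> a = L a + (\<delta> 1 - L 1) * a"
proof -
  have "additive L" and L: "\<And>a b. L (a * b - scale \<xi> (b * a)) =
      L a * b - scale \<xi> (b * L a) + (a * L b - scale \<xi> (L b * a))"
    and \<delta>: "\<And>a b. \<delta> (a * b - scale \<xi> (b * a)) =
      \<delta> a * b - scale \<xi> (\<delta> b * a) + a * L b - scale \<xi> (b * L a)"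
    using rel
    by (auto simp: relating_xi_Lie_derivation_def xi_Lie_derivation_def xi_bracket_def)
  define D where "D a = \<delta> a - L a" for a
  have D_diff: "D (a - b) = D a - D b" for a b
    by (simp add: D_def additive.diff[OF \<open>additive L\<close>] additive.diff[OF \<open>additive \<delta>\<close>])
  have D: "D (a * b - scale \<xi> (b * a)) = D a * b - scale \<xi> (D b * a)" for a b
    by (simp add: D_def L \<delta> algebra_simps)
  have "D a = D 1 * a"
  proof (cases "\<xi> = - 1")
    case True
    have "D (a + a) = D a + D a"
      by (simp add: D_def additive.add[OF \<open>additive L\<close>] additive.add[OF \<open>additive \<delta>\<close>])
    with D[of a 1] True show ?thesis by simp
  next
    case False
    have "D a - scale \<xi> (D 1 * a) = D 1 * a - scale \<xi> (D a)"
      using D[of a 1] D[of 1 a] by simp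
    hence "scale (1 + \<xi>) (D a - D 1 * a) = 0" by (simp add: algebra_simps)
    moreover have "1 + \<xi> \<noteq> 0" using False by (simp add: eq_neg_iff_add_eq_0 add.commute)
    ultimately show ?thesis by simp
  qed
  thus ?thesis by (simp add: D_def algebra_simps)
qed

lemma generalized_derivation_plus_left_mult:
  assumes "additive \<delta>" "additive d" "\<And>a b. d (a * b) = d a * b + a * d b"
    and "\<And>a. \<delta> a = d a + s * a"
  shows "generalized_derivation \<delta>"
  unfolding generalized_derivation_into_def derivation_into_def
  using assms(1) by (auto intro!: exI[of _ d] simp: assms(2-) algebra_simps)

lemma (in unital_algebra) xi_Lie_derivation_at_one:
  assumes "additive L" "\<xi> \<noteq> - 1"
    and L: "\<And>a b. L (a * b - scale \<xi> (b * a)) =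
      L a * b - scale \<xi> (b * L a) + (a * L b - scale \<xi> (L b * a))"
  shows "L 1 * a = a * L 1" "L (scale \<xi> a) = scale \<xi> (L a) - scale (1 - \<xi>) (L 1 * a)"
proof -
  have xi: "1 + \<xi> \<noteq> 0" using assms(2) by (simp add: eq_neg_iff_add_eq_0 add.commute)
  have 1: "L (a - scale \<xi> a) = L a - scale \<xi> (L a) + (a * L 1 - scale \<xi> (L 1 * a))"
    using L[of a 1] by simp
  have 2: "L (a - scale \<xi> a) = L 1 * a - scale \<xi> (a * L 1) + (L a - scale \<xi> (L a))"
    using L[of 1 a] by simp
  from 1[unfolded 2] have "scale (1 + \<xi>) (L 1 * a - a * L 1) = 0"
    by (simp add: algebra_simps)
  with xi show comm: "L 1 * a = a * L 1" by simp
  show "L (scale \<xi> a) = scale \<xi> (L a) - scale (1 - \<xi>) (L 1 * a)"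
    using L[of 1 a] by (simp add: comm additive.diff[OF assms(1)] algebra_simps)
qed

context prime_ring
begin

text \<open>With \<open>c = [x, y]\<close>, the product \<open>c x = [x, y x]\<close> is again a
  commutator; it commutes with \<open>y\<close>, which gives \<open>c c = 0\<close>. A central
  \<open>c\<close> with square zero vanishes by primeness.\<close>

lemma commutative_of_central_commutators:
  fixes x y :: 'a
  assumes central: "\<And>a x b :: 'a. (a * x - x * a) * b = b * (a * x - x * a)"
  shows "x * y = y * x"
proof -
  let ?c = "x * y - y * x"
  have "?c * ?c = ?c * x * y - y * (?c * x) + (y * ?c - ?c * y) * x"
    by (simp add: algebra_simps)
  also have "?c * x = x * (y * x) - (y * x) * x" by (simp add: algebra_simps)
  also have "(x * (y * x) - (y * x) * x) * y = y * (x * (y * x) - (y * x) * x)"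
    by (rule central)
  also have "y * ?c = ?c * y" by (rule central[symmetric])
  finally have "?c * ?c = 0" by simp
  hence "?c * z * ?c = 0" for z by (simp only: central[of x y z] mult.assoc mult_zero_right)
  with prime have "?c = 0" by blast
  thus ?thesis by simp
qed

lemma not_commutative_of_nontrivial_idempotent:
  fixes p :: 'a
  assumes "nontrivial_idempotent p"
  obtains x y :: 'a where "x * y \<noteq> y * x"
proof (rule ccontr)
  assume "\<not> thesis"
  with that have comm: "\<And>x y :: 'a. x * y = y * x" by blast
  have "p * x * (1 - p) = 0" for x
  proof -
    have "p * x * (1 - p) = x * (p - p * p)"
      by (subst comm[of p x]) (simp add: algebra_simps)
    thus ?thesis using assms by (simp add: nontrivial_idempotent_def)
  qed
  with prime[of p "1 - p"] assms show False by (simp add: nontrivial_idempotent_def)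
qed

end

context unital_prime_algebra
begin

lemma prime_ring: "prime_ring TYPE('a)"
  by standard (use prime in blast)

lemma generalized_Lie_derivation_decomposition:
  assumes \<delta>: "additive \<delta>" and rel: "relating_xi_Lie_derivation scale 1 \<delta> L"
    and deg: "deg_alg TYPE('a) \<ge> 3"
  shows "\<exists>(\<delta>' :: 'a \<Rightarrow> 'a qmr) h. generalized_derivation_into to_qmr central_closure \<delta>' \<and>
    additive h \<and> range h \<subseteq> extended_centroid \<and> (\<forall>a b. h (commutator a b) = 0) \<and>
    (\<forall>a. to_qmr (\<delta> a) = \<delta>' a + h a)"
proof -
  obtain t :: 'a where t: "to_qmr t * to_qmr t \<notin> cent.span {1, to_qmr t}"
    using prime_ring.ex_nonquadratic[OF prime_ring deg] by blast
  have L: "additive L" "\<And>a b. L (commutator a b) = commutator (L a) b + commutator a (L b)"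
    using rel by (auto simp: relating_xi_Lie_derivation_def xi_Lie_derivation_def
        xi_bracket_def commutator_def)
  interpret lie_derivation "TYPE('a)" t "\<lambda>a. to_qmr (L a)"
  proof (intro lie_derivation.intro nonquadratic.intro prime_ring nonquadratic_axioms.intro t
      lie_derivation_axioms.intro)
    show "additive (\<lambda>a. to_qmr (L a))"
      by standard (simp add: additive.add[OF L(1)] to_qmr_add)
    show "to_qmr (L (commutator x y)) =
        commutator (to_qmr (L x)) (to_qmr y) + commutator (to_qmr x) (to_qmr (L y))" for x y
      by (simp add: L(2)) (simp add: commutator_def to_qmr_simps)
  qed
  define s where "s = \<delta> 1 - L 1"
  have \<delta>_eq: "\<delta> a = L a + s * a" for a
    unfolding s_def by (rule relating_difference[OF \<delta> rel])
  \<comment> \<open>\<open>h a \<cdot> 1\<close> is a central multiple of the unit, so it lies in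
    every \<open>centroid_subalgebra\<close> containing the ring.\<close>
  have closure: "to_qmr x - h a \<cdot> 1 \<in> central_closure" for x a
    unfolding central_closure_def hull_def
  proof clarify
    fix S :: "'a qmr set"
    assume S: "centroid_subalgebra S" "range to_qmr \<subseteq> S"
    have "Rep_cent (- h a) * to_qmr 1 \<in> S"
      using S Rep_cent[of "- h a"] by (auto simp: centroid_subalgebra_def)
    hence "to_qmr x + Rep_cent (- h a) * to_qmr 1 \<in> S"
      using S by (auto simp: centroid_subalgebra_def)
    thus "to_qmr x - h a \<cdot> 1 \<in> S"
      by (simp add: cscale_def to_qmr_one uminus_cent.rep_eq)
  qed
  let ?\<delta>' = "\<lambda>a. to_qmr (\<delta> a) - h a \<cdot> 1" and ?\<tau> = "\<lambda>a. to_qmr (L a) - h a \<cdot> 1"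
  have additive: "additive ?\<delta>'" "additive ?\<tau>" "additive (\<lambda>a. h a \<cdot> (1 :: 'a qmr))"
    by (standard; simp add: additive.add[OF \<delta>] additive.add[OF L(1)] h_simps to_qmr_add
        cent.scale_left_distrib algebra_simps)+
  have "derivation_into to_qmr central_closure ?\<tau>"
    unfolding derivation_into_def using additive(2) closure derivation_plus_central(1) by auto
  moreover have "?\<delta>' (a * b) = ?\<delta>' a * to_qmr b + to_qmr a * ?\<tau> b" for a b
    using derivation_plus_central(1)[of a b]
    by (simp add: \<delta>_eq to_qmr_add to_qmr_mult algebra_simps)
  ultimately have "generalized_derivation_into to_qmr central_closure ?\<delta>'"
    unfolding generalized_derivation_into_def using additive(1) closure by blast
  moreover have "h a \<cdot> 1 \<in> extended_centroid" for a
    unfolding cscale_one by (rule Rep_cent)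
  ultimately show ?thesis
    using additive(3) derivation_plus_central(2)
    by (intro exI[of _ ?\<delta>'] exI[of _ "\<lambda>a. h a \<cdot> 1"]) auto
qed

lemma generalized_Jordan_derivation:
  assumes \<delta>: "additive \<delta>" and rel: "relating_xi_Lie_derivation scale (- 1) \<delta> L"
    and char: "CHAR('f) \<noteq> 2"
  shows "generalized_derivation \<delta>"
proof -
  have L: "additive L" "\<And>a b. L (a * b + b * a) = L a * b + a * L b + L b * a + b * L a"
    using rel by (auto simp: relating_xi_Lie_derivation_def xi_Lie_derivation_def
        xi_bracket_def algebra_simps)
  have "(2 :: 'f) \<noteq> 0"
  proof
    assume "(2 :: 'f) = 0"
    hence "of_nat 2 = (0 :: 'f)" by simp
    hence "CHAR('f) dvd 2" by (simp only: of_nat_eq_0_iff_char_dvd)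
    hence "CHAR('f) \<le> 2" "CHAR('f) \<noteq> 0"
      by (simp add: dvd_imp_le, metis dvd_0_left zero_neq_numeral)
    hence "CHAR('f) = 1" using char by linarith
    thus False by (metis of_nat_CHAR of_nat_1 one_neq_zero)
  qed
  moreover have "x + x = scale 2 x" for x
    using scale_left_distrib[of 1 1 x] by simp
  ultimately have "\<And>x :: 'a. x + x = 0 \<Longrightarrow> x = 0" by simp
  from prime_ring.jordan_derivation[OF prime_ring this L]
  show ?thesis
    using relating_difference[OF \<delta> rel] by (rule generalized_derivation_plus_left_mult[OF \<delta> L(1)])
qed

lemma generalized_xi_Lie_derivation_with_idempotent:
  fixes p :: 'a
  assumes \<delta>: "additive \<delta>" and rel: "relating_xi_Lie_derivation scale \<xi> \<delta> L"
    and \<xi>: "\<xi> \<noteq> 1" "\<xi> \<noteq> - 1" and p: "nontrivial_idempotent p"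
  shows "generalized_derivation \<delta>" "\<delta> (scale \<xi> a) = scale \<xi> (\<delta> a)"
proof -
  have "additive L" and L: "\<And>a b. L (a * b - scale \<xi> (b * a)) =
      L a * b - scale \<xi> (b * L a) + (a * L b - scale \<xi> (L b * a))"
    using rel by (auto simp: relating_xi_Lie_derivation_def xi_Lie_derivation_def xi_bracket_def)
  define c where "c = L 1"
  have c: "c * a = a * c" and L_scale: "L (scale \<xi> a) = scale \<xi> (L a) - scale (1 - \<xi>) (c * a)" for a
    unfolding c_def by (rule xi_Lie_derivation_at_one[OF \<open>additive L\<close> \<xi>(2) L])+
  have c': "a * (c * b) = c * (a * b)" for a b
    by (metis c mult.assoc)
  define G where "G a b = L (a * b) - L a * b - a * L b" for a b
  have G1: "G a b - scale \<xi> (G b a) = - scale (1 - \<xi>) (c * (b * a))" for a b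
    using L[of a b] by (simp add: G_def additive.diff[OF \<open>additive L\<close>] L_scale algebra_simps)
  \<comment> \<open>\<open>G1\<close> at \<open>(a, b)\<close> and at \<open>(b, a)\<close>
    eliminates \<open>G b a\<close>; the factor \<open>1 - \<xi>\<close> cancels.\<close>
  have G: "scale (1 + \<xi>) (G a b) = - (c * (b * a + scale \<xi> (a * b)))" for a b
  proof -
    have "scale (1 - \<xi>) (scale (1 + \<xi>) (G a b)) =
        (G a b - scale \<xi> (G b a)) + scale \<xi> (G b a - scale \<xi> (G a b))"
      by (simp add: algebra_simps)
    also have "\<dots> = scale (1 - \<xi>) (- (c * (b * a + scale \<xi> (a * b))))"
      unfolding G1 by (simp add: scale_mult_right algebra_simps)
    finally show ?thesis using \<xi>(1) unfolding scale_cancel_left by simp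
  qed
  have cocycle: "a * G b x - G (a * b) x + G a (b * x) - G a b * x = 0" for a b x
    by (simp add: G_def algebra_simps)
  have c_double: "c * ((a * x - x * a) * b - b * (a * x - x * a)) = 0" for a b x
  proof -
    have "0 = - scale (1 + \<xi>) (a * G b x - G (a * b) x + G a (b * x) - G a b * x)"
      by (simp add: cocycle)
    also have "\<dots> = - (a * scale (1 + \<xi>) (G b x) - scale (1 + \<xi>) (G (a * b) x)
        + scale (1 + \<xi>) (G a (b * x)) - scale (1 + \<xi>) (G a b) * x)"
      by (simp only: scale_right_distrib scale_right_diff_distrib scale_mult_left scale_mult_right)
    also have "\<dots> = c * ((a * x - x * a) * b - b * (a * x - x * a))"
      unfolding G by (simp add: c' scale_mult_left scale_mult_right algebra_simps)
    finally show ?thesis by simp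
  qed
  have "c = 0"
  proof (rule ccontr)
    assume "c \<noteq> 0"
    have "(a * x - x * a) * b = b * (a * x - x * a)" for a x b :: 'a
    proof -
      let ?e = "(a * x - x * a) * b - b * (a * x - x * a)"
      have "c * y * ?e = 0" for y
        using c_double[of a x b] by (simp add: c mult.assoc)
      with prime[of c ?e] \<open>c \<noteq> 0\<close> show ?thesis by simp
    qed
    hence "x * y = y * x" for x y :: 'a
      by (rule prime_ring.commutative_of_central_commutators[OF prime_ring])
    with prime_ring.not_commutative_of_nontrivial_idempotent[OF prime_ring p] show False by blast
  qed
  moreover have "1 + \<xi> \<noteq> 0" using \<xi>(2) by (simp add: eq_neg_iff_add_eq_0 add.commute)
  ultimately have "G a b = 0" for a b using G[of a b] by simp
  hence "L (a * b) = L a * b + a * L b" for a b by (simp add: G_def algebra_simps)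
  thus "generalized_derivation \<delta>"
    using relating_difference[OF \<delta> rel]
    by (rule generalized_derivation_plus_left_mult[OF \<delta> \<open>additive L\<close>])
  show "\<delta> (scale \<xi> a) = scale \<xi> (\<delta> a)"
    unfolding relating_difference[OF \<delta> rel, of a] relating_difference[OF \<delta> rel, of "scale \<xi> a"]
    using L_scale[of a] \<open>c = 0\<close> by (simp add: scale_mult_right scale_right_distrib)
qed

end

theorem theorem3p1:
  fixes scale :: "'f::field \<Rightarrow> 'a::ring_1 \<Rightarrow> 'a"
    and \<xi> :: 'f
    and \<delta> L :: "'a \<Rightarrow> 'a"
  assumes "unital_prime_algebra scale"
    and "\<xi> \<noteq> 0"
    and "generalized_xi_Lie_derivation scale \<xi> \<delta>"
    and "relating_xi_Lie_derivation scale \<xi> \<delta> L"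
  shows "(\<xi> = 1 \<and> deg_alg TYPE('a) \<ge> 3 \<longrightarrow>
      (\<exists>(\<delta>' :: 'a \<Rightarrow> 'a qmr) (h :: 'a \<Rightarrow> 'a qmr).
        generalized_derivation_into to_qmr central_closure \<delta>' \<and>
        additive h \<and> range h \<subseteq> extended_centroid \<and> (\<forall>a b. h (commutator a b) = 0) \<and>
        (\<forall>a. to_qmr (\<delta> a) = \<delta>' a + h a)))
    \<and> (\<xi> = - 1 \<and> CHAR('f) \<noteq> 2 \<longrightarrow> generalized_derivation \<delta>)
    \<and> (\<xi> \<noteq> 1 \<and> \<xi> \<noteq> - 1 \<and> CHAR('f) \<noteq> 2 \<and> (\<exists>p :: 'a. nontrivial_idempotent p) \<longrightarrow>
      generalized_derivation \<delta> \<and> (\<forall>a. \<delta> (scale \<xi> a) = scale \<xi> (\<delta> a)))"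
proof -
  interpret unital_prime_algebra scale by fact
  have \<delta>: "additive \<delta>" using assms(3) by (simp add: generalized_xi_Lie_derivation_def)
  note rel = assms(4)
  show ?thesis
    using generalized_Lie_derivation_decomposition[OF \<delta>, of L]
      generalized_Jordan_derivation[OF \<delta>, of L]
      generalized_xi_Lie_derivation_with_idempotent[OF \<delta> rel] rel
    by blast
qed

end
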